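(* For any set $\Gamma\cup\{\phi\}$ of $\mathbf{CPL}(\dot\vee)$-formulas, $\Gamma\models\phi$ if and only if $\Gamma\vdash\phi$, where $\vdash$ is derivability in the natural deduction system of $\mathbf{CPL}(\dot\vee)$.
   Context: Fix a set $\mathsf{Prop}$ of propositional variables. Classical formulas: $\alpha::=p\mid\bot\mid\top\mid\neg\alpha\mid(\alpha\wedge\alpha)\mid(\alpha\vee\alpha)$ with $p\in\mathsf{Prop}$. Formulas of $\mathbf{CPL}(\dot\vee)$: $\phi::=p\mid\bot\mid\top\mid\neg\alpha\mid(\phi\wedge\phi)\mid(\phi\vee\phi)\mid(\phi\mathbin{\dot\vee}\phi)$ with $\alpha$ classical ($\dot\vee$ is the relevant disjunction). For $\mathsf N\subseteq\mathsf{Prop}$, a valuation on $\mathsf N$ is a function $v:\mathsf N\cup\{\bot,\top\}\to\{0,1\}$ with $v(\bot)=0$, $v(\top)=1$; an $\mathsf N$-team is a set $X$ of valuations on $\mathsf N$, with $\mathsf{dom}(X)=\mathsf N$ (the empty set is a team of any domain). Team semantics, for $X$ whose domain contains the variables $\mathsf{Prop}(\phi)$ of $\phi$: $X\models p$ iff $v(p)=1$ for all $v\in X$; $X\models\bot$ iff $X=\emptyset$; $X\models\top$ always; $X\models\neg\alpha$ iff $\{v\}\not\models\alpha$ for all $v\in X$; $X\models\phi\wedge\psi$ iff $X\models\phi$ and $X\models\psi$; $X\models\phi\vee\psi$ iff there are $Y,Z\subseteq X$ with $X=Y\cup Z$, $Y\models\phi$, $Z\models\psi$; $X\models\phi\mathbin{\dot\vee}\psi$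 iff $X=\emptyset$ or there are nonempty $Y,Z\subseteq X$ with $X=Y\cup Z$, $Y\models\phi$, $Z\models\psi$. $\Gamma\models\phi$ means: every team $X$ whose domain contains all variables of $\Gamma\cup\{\phi\}$ and which satisfies every $\gamma\in\Gamma$ satisfies $\phi$. Natural deduction system of $\mathbf{CPL}(\dot\vee)$: $\Gamma\vdash\phi$ means there is a derivation of $\phi$ all of whose undischarged assumptions lie in $\Gamma$. In sequent notation, $\vdash$ is the least relation such that $\Gamma\vdash\phi$ for $\phi\in\Gamma$, $\Gamma\vdash\phi$ implies $\Gamma\cup\Gamma'\vdash\phi$, and which is closed under the following rules, where $\alpha$ ranges over classical formulas, $\phi,\psi,\chi$ over all formulas, $\Gamma$ over sets of formulas, and $\Delta$ over sets of classical formulas only: - $\top$I: $\Gamma\vdash\top$. - $\neg$I: from $\Delta,\alpha\vdash\bot$ infer $\Delta\vdash\neg\alpha$. - RAA: from $\Delta,\neg\alpha\vdash\bot$ infer $\Delta\vdash\alpha$. - $\neg$E: from $\Gamma\vdash\alpha$ and $\Gamma\vdash\neg\alpha$ infer $\Gamma\vdash\phi$. - $\wedge$I: from $\Gamma\vdash\phi$ and $\Gamma\vdash\psi$ infer $\Gamma\vdash\phi\wedge\psi$. $\wedge$E: from $\Gamma\vdash\phi\wedge\psi$ infer $\Gamma\vdash\phi$, and infer $\Gamma\vdash\psi$. - $\vee$I: from $\Gamma\vdash\phi$ infer $\Gamma\vdash\phi\vee\psi$, and infer $\Gamma\vdash\psi\vee\phi$. - $\vee$E: from $\Gamma\vdash\phi\vee\psi$,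 $\Delta,\phi\vdash\chi$ and $\Delta,\psi\vdash\chi$ infer $\Gamma\cup\Delta\vdash\chi$. - $\dot\vee$I: from $\Gamma\vdash\phi$ and $\Gamma\vdash\psi$ infer $\Gamma\vdash\phi\mathbin{\dot\vee}\psi$. - $\dot\vee$Mon: from $\Gamma\vdash\phi\mathbin{\dot\vee}\psi$ and $\Delta,\phi\vdash\chi$ infer $\Gamma\cup\Delta\vdash\chi\mathbin{\dot\vee}\psi$. - $\dot\vee$Com: from $\Gamma\vdash\phi\mathbin{\dot\vee}\psi$ infer $\Gamma\vdash\psi\mathbin{\dot\vee}\phi$. $\dot\vee$Ass: from $\Gamma\vdash\phi\mathbin{\dot\vee}(\psi\mathbin{\dot\vee}\chi)$ infer $\Gamma\vdash(\phi\mathbin{\dot\vee}\psi)\mathbin{\dot\vee}\chi$. - $\vee\mathrm{E}_{\dot\vee}$: from $\Gamma\vdash\phi\vee\psi$, $\Gamma,\phi\vdash\chi$, $\Gamma,\psi\vdash\chi$ and $\Gamma,\phi\mathbin{\dot\vee}\psi\vdash\chi$ infer $\Gamma\vdash\chi$. - $\dot\vee\vee$Tr: from $\Gamma\vdash\phi\mathbin{\dot\vee}\psi$ infer $\Gamma\vdash\phi\vee\psi$. - $\dot\vee\bot$E: from $\Gamma\vdash\phi\mathbin{\dot\vee}\bot$ infer $\Gamma\vdash\psi$. - Dstr$\dot\vee\vee$: from $\Gamma\vdash\phi\mathbin{\dot\vee}(\psi\vee\chi)$ infer $\Gamma\vdash(\phi\mathbin{\dot\vee}\psi)\vee(\phi\mathbin{\dot\vee}\chi)$.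 *)

theory Defs
  imports Main
begin

text \<open>The type variable \<open>'p\<close> is the arbitrary set of propositional variables. Since negation applies to
  classical formulas only, there are two datatypes; \<open>emb\<close> is the inclusion of the classical formulas
  into the formulas of the logic. \<open>Rel\<close> is the relevant disjunction.\<close>

datatype 'p cfm =
    CVar 'p
  | CBot
  | CTop
  | CNeg "'p cfm"
  | CAnd "'p cfm" "'p cfm"
  | COr "'p cfm" "'p cfm"

datatype 'p fm =
    Var 'p
  | Bot
  | Top
  | Neg "'p cfm"
  | And "'p fm" "'p fm"  (infixr "\<^bold>\<and>" 70)
  | Or "'p fm" "'p fm"  (infixr "\<^bold>\<or>" 65)
  | Rel "'p fm" "'p fm"  (infixr "\<or>\<^sub>r" 65)

primrec emb :: "'p cfm \<Rightarrow> 'p fm" where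
  "emb (CVar p) = Var p"
| "emb CBot = Bot"
| "emb CTop = Top"
| "emb (CNeg \<alpha>) = Neg \<alpha>"
| "emb (CAnd \<alpha> \<beta>) = emb \<alpha> \<^bold>\<and> emb \<beta>"
| "emb (COr \<alpha> \<beta>) = emb \<alpha> \<^bold>\<or> emb \<beta>"

definition classical :: "'p fm set" where
  "classical = range emb"

primrec cprops :: "'p cfm \<Rightarrow> 'p set" where
  "cprops (CVar p) = {p}"
| "cprops CBot = {}"
| "cprops CTop = {}"
| "cprops (CNeg \<alpha>) = cprops \<alpha>"
| "cprops (CAnd \<alpha> \<beta>) = cprops \<alpha> \<union> cprops \<beta>"
| "cprops (COr \<alpha> \<beta>) = cprops \<alpha> \<union> cprops \<beta>"

primrec props :: "'p fm \<Rightarrow> 'p set" where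
  "props (Var p) = {p}"
| "props Bot = {}"
| "props Top = {}"
| "props (Neg \<alpha>) = cprops \<alpha>"
| "props (\<phi> \<^bold>\<and> \<psi>) = props \<phi> \<union> props \<psi>"
| "props (\<phi> \<^bold>\<or> \<psi>) = props \<phi> \<union> props \<psi>"
| "props (\<phi> \<or>\<^sub>r \<psi>) = props \<phi> \<union> props \<psi>"

text \<open>A valuation on \<open>N\<close> is a partial function with domain exactly \<open>N\<close>; its values at the two constants
  are fixed and hence not recorded. The empty set is a team on every \<open>N\<close>.\<close>

type_synonym 'p valuation = "'p \<rightharpoonup> bool"

definition is_team :: "'p set \<Rightarrow> 'p valuation set \<Rightarrow> bool" where
  "is_team N X \<longleftrightarrow> (\<forall>v\<in>X. dom v = N)"

lemma size_emb [simp]: "size (emb \<alpha>) = size \<alpha>"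
  by (induction \<alpha>) simp_all

text \<open>Satisfaction is only meaningful for teams whose domain contains the variables of the formula;
  \<open>entails\<close> imposes this.\<close>

function sat :: "'p valuation set \<Rightarrow> 'p fm \<Rightarrow> bool"  (infix "\<Turnstile>" 50) where
  "X \<Turnstile> Var p \<longleftrightarrow> (\<forall>v\<in>X. v p = Some True)"
| "X \<Turnstile> Bot \<longleftrightarrow> X = {}"
| "X \<Turnstile> Top \<longleftrightarrow> True"
| "X \<Turnstile> Neg \<alpha> \<longleftrightarrow> (\<forall>v\<in>X. \<not> {v} \<Turnstile> emb \<alpha>)"
| "X \<Turnstile> (\<phi> \<^bold>\<and> \<psi>) \<longleftrightarrow> X \<Turnstile> \<phi> \<and> X \<Turnstile> \<psi>"
| "X \<Turnstile> (\<phi> \<^bold>\<or> \<psi>) \<longleftrightarrow>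
     (\<exists>Y Z. Y \<subseteq> X \<and> Z \<subseteq> X \<and> X = Y \<union> Z \<and> Y \<Turnstile> \<phi> \<and> Z \<Turnstile> \<psi>)"
| "X \<Turnstile> (\<phi> \<or>\<^sub>r \<psi>) \<longleftrightarrow> X = {} \<or>
     (\<exists>Y Z. Y \<noteq> {} \<and> Z \<noteq> {} \<and> Y \<subseteq> X \<and> Z \<subseteq> X \<and> X = Y \<union> Z \<and> Y \<Turnstile> \<phi> \<and> Z \<Turnstile> \<psi>)"
  by pat_completeness auto
termination
  by (relation "measure (\<lambda>(X, \<phi>). size \<phi>)") simp_all

definition entails :: "'p fm set \<Rightarrow> 'p fm \<Rightarrow> bool"  (infix "\<TTurnstile>" 50) where
  "\<Gamma> \<TTurnstile> \<phi> \<longleftrightarrow>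
     (\<forall>N X. is_team N X \<longrightarrow> (\<Union>\<psi>\<in>\<Gamma> \<union> {\<phi>}. props \<psi>) \<subseteq> N \<longrightarrow>
        (\<forall>\<gamma>\<in>\<Gamma>. X \<Turnstile> \<gamma>) \<longrightarrow> X \<Turnstile> \<phi>)"

inductive derives :: "'p fm set \<Rightarrow> 'p fm \<Rightarrow> bool"  (infix "\<turnstile>" 50) where
  Assm: "\<phi> \<in> \<Gamma> \<Longrightarrow> \<Gamma> \<turnstile> \<phi>"
| Weak: "\<Gamma> \<turnstile> \<phi> \<Longrightarrow> \<Gamma> \<union> \<Gamma>' \<turnstile> \<phi>"
| TopI: "\<Gamma> \<turnstile> Top"
| NegI: "\<Delta> \<subseteq> classical \<Longrightarrow> \<Delta> \<union> {emb \<alpha>} \<turnstile> Bot \<Longrightarrow> \<Delta> \<turnstile> Neg \<alpha>"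
| RAA: "\<Delta> \<subseteq> classical \<Longrightarrow> \<Delta> \<union> {Neg \<alpha>} \<turnstile> Bot \<Longrightarrow> \<Delta> \<turnstile> emb \<alpha>"
| NegE: "\<Gamma> \<turnstile> emb \<alpha> \<Longrightarrow> \<Gamma> \<turnstile> Neg \<alpha> \<Longrightarrow> \<Gamma> \<turnstile> \<phi>"
| AndI: "\<Gamma> \<turnstile> \<phi> \<Longrightarrow> \<Gamma> \<turnstile> \<psi> \<Longrightarrow> \<Gamma> \<turnstile> (\<phi> \<^bold>\<and> \<psi>)"
| AndE1: "\<Gamma> \<turnstile> (\<phi> \<^bold>\<and> \<psi>) \<Longrightarrow> \<Gamma> \<turnstile> \<phi>"
| AndE2: "\<Gamma> \<turnstile> (\<phi> \<^bold>\<and> \<psi>) \<Longrightarrow> \<Gamma> \<turnstile> \<psi>"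
| OrI1: "\<Gamma> \<turnstile> \<phi> \<Longrightarrow> \<Gamma> \<turnstile> (\<phi> \<^bold>\<or> \<psi>)"
| OrI2: "\<Gamma> \<turnstile> \<phi> \<Longrightarrow> \<Gamma> \<turnstile> (\<psi> \<^bold>\<or> \<phi>)"
| OrE: "\<Delta> \<subseteq> classical \<Longrightarrow> \<Gamma> \<turnstile> (\<phi> \<^bold>\<or> \<psi>) \<Longrightarrow> \<Delta> \<union> {\<phi>} \<turnstile> \<chi> \<Longrightarrow> \<Delta> \<union> {\<psi>} \<turnstile> \<chi> \<Longrightarrow>
    \<Gamma> \<union> \<Delta> \<turnstile> \<chi>"
| RelI: "\<Gamma> \<turnstile> \<phi> \<Longrightarrow> \<Gamma> \<turnstile> \<psi> \<Longrightarrow> \<Gamma> \<turnstile> (\<phi> \<or>\<^sub>r \<psi>)"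
| RelMon: "\<Delta> \<subseteq> classical \<Longrightarrow> \<Gamma> \<turnstile> (\<phi> \<or>\<^sub>r \<psi>) \<Longrightarrow> \<Delta> \<union> {\<phi>} \<turnstile> \<chi> \<Longrightarrow> \<Gamma> \<union> \<Delta> \<turnstile> (\<chi> \<or>\<^sub>r \<psi>)"
| RelCom: "\<Gamma> \<turnstile> (\<phi> \<or>\<^sub>r \<psi>) \<Longrightarrow> \<Gamma> \<turnstile> (\<psi> \<or>\<^sub>r \<phi>)"
| RelAss: "\<Gamma> \<turnstile> (\<phi> \<or>\<^sub>r (\<psi> \<or>\<^sub>r \<chi>)) \<Longrightarrow> \<Gamma> \<turnstile> ((\<phi> \<or>\<^sub>r \<psi>) \<or>\<^sub>r \<chi>)"
| OrERel: "\<Gamma> \<turnstile> (\<phi> \<^bold>\<or> \<psi>) \<Longrightarrow> \<Gamma> \<union> {\<phi>} \<turnstile> \<chi> \<Longrightarrow> \<Gamma> \<union> {\<psi>} \<turnstile> \<chi> \<Longrightarrow>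
    \<Gamma> \<union> {\<phi> \<or>\<^sub>r \<psi>} \<turnstile> \<chi> \<Longrightarrow> \<Gamma> \<turnstile> \<chi>"
| RelOrTr: "\<Gamma> \<turnstile> (\<phi> \<or>\<^sub>r \<psi>) \<Longrightarrow> \<Gamma> \<turnstile> (\<phi> \<^bold>\<or> \<psi>)"
| RelBotE: "\<Gamma> \<turnstile> (\<phi> \<or>\<^sub>r Bot) \<Longrightarrow> \<Gamma> \<turnstile> \<psi>"
| DstrRelOr: "\<Gamma> \<turnstile> (\<phi> \<or>\<^sub>r (\<psi> \<^bold>\<or> \<chi>)) \<Longrightarrow> \<Gamma> \<turnstile> ((\<phi> \<or>\<^sub>r \<psi>) \<^bold>\<or> (\<phi> \<or>\<^sub>r \<chi>))"

end

theory Submission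
  imports Defs
begin

text \<open>
  Soundness is an induction over derivations. It rests on three semantic facts: every formula holds in
  the empty team, every formula is preserved by unions of teams, and classical formulas are flat
  (\<open>classical_flat\<close>), which is why only classical side assumptions \<open>\<Delta>\<close> may be carried into
  the subteams of a split team.

  Completeness combines a normal form with a canonical team.

  A team satisfies a relevant disjunction \<open>rels xs\<close> of classical formulas iff each of its valuations
  satisfies some member of \<open>xs\<close> and, unless the team is empty, each member of \<open>xs\<close> holds at some
  valuation. Proof-theoretically, too, \<open>rels xs\<close> amounts to the classical formula \<open>ors xs\<close>
  together with the formulas \<open>x \<or>\<^sub>r Top\<close>, which say that \<open>x\<close> holds somewhere (\<open>rels_intro\<close>).
  Every formula is provably equivalent to a disjunction of such basic formulas
  (\<open>normal_form_exists\<close>). The tensor disjunction is not a choice between its disjuncts: a team may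
  be split among several of them. But then it satisfies their relevant disjunction, which is again
  basic. After closing the list of disjuncts under concatenation (\<open>joins\<close>), the
  disjunction can therefore be eliminated by cases, in derivations with arbitrary side assumptions
  (\<open>ors_rels_elim\<close>) as well as in nonempty teams (\<open>sat_ors_joins\<close>).

  Now let \<open>\<Gamma> \<turnstile> \<chi>\<close> fail, and extend \<open>\<Gamma>\<close> to a set \<open>T\<close> that is maximal among the sets
  not deriving \<open>\<chi>\<close>. Let \<open>X\<close> be the set of all valuations of all variables that satisfy the
  classical members of \<open>T\<close>. By completeness of the classical fragment, \<open>T\<close> contains exactly the
  classical formulas true throughout \<open>X\<close>, and \<open>x \<or>\<^sub>r Top\<close> lies in \<open>T\<close> iff the classical
  formula \<open>x\<close> holds somewhere in \<open>X\<close>. Hence \<open>T\<close> and \<open>X\<close> agree on all basic formulas. A member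
  of \<open>T\<close> is implied by a basic formula in \<open>T\<close>, so it holds in \<open>X\<close>; and if \<open>\<chi>\<close> held in
  \<open>X\<close>, then so would a basic formula implying \<open>\<chi>\<close>, which would put \<open>\<chi>\<close> into \<open>T\<close>.
  This argument works directly with infinite \<open>\<Gamma>\<close> and arbitrarily many variables.
\<close>

section \<open>Soundness\<close>

lemma empty_sat [simp]: "{} \<Turnstile> \<phi>"
  by (induction \<phi>) auto

lemma sat_OrI: "Y \<Turnstile> \<phi> \<Longrightarrow> Z \<Turnstile> \<psi> \<Longrightarrow> X = Y \<union> Z \<Longrightarrow> X \<Turnstile> (\<phi> \<^bold>\<or> \<psi>)"
  unfolding sat.simps(6) by (intro exI[of _ Y] exI[of _ Z]) simp

lemma sat_RelI:
  "Y \<Turnstile> \<phi> \<Longrightarrow> Z \<Turnstile> \<psi> \<Longrightarrow> X = Y \<union> Z \<Longrightarrow> Y \<noteq> {} \<Longrightarrow> Z \<noteq> {} \<Longrightarrow> X \<Turnstile> (\<phi> \<or>\<^sub>r \<psi>)"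
  unfolding sat.simps(7) by (intro disjI2 exI[of _ Y] exI[of _ Z]) simp

lemma sat_OrE:
  assumes "X \<Turnstile> (\<phi> \<^bold>\<or> \<psi>)"
  obtains Y Z where "X = Y \<union> Z" "Y \<Turnstile> \<phi>" "Z \<Turnstile> \<psi>"
  using assms unfolding sat.simps(6) by metis

lemma sat_RelE:
  assumes "X \<Turnstile> (\<phi> \<or>\<^sub>r \<psi>)" "X \<noteq> {}"
  obtains Y Z where "X = Y \<union> Z" "Y \<Turnstile> \<phi>" "Z \<Turnstile> \<psi>" "Y \<noteq> {}" "Z \<noteq> {}"
  using assms unfolding sat.simps(7) by metis

lemma sat_Un: "X \<Turnstile> \<phi> \<Longrightarrow> Y \<Turnstile> \<phi> \<Longrightarrow> X \<union> Y \<Turnstile> \<phi>"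
proof (induction \<phi> arbitrary: X Y)
  case (Or \<phi> \<psi>)
  obtain A B where AB: "X = A \<union> B" "A \<Turnstile> \<phi>" "B \<Turnstile> \<psi>"
    using Or.prems(1) by (rule sat_OrE)
  obtain C D where CD: "Y = C \<union> D" "C \<Turnstile> \<phi>" "D \<Turnstile> \<psi>"
    using Or.prems(2) by (rule sat_OrE)
  show ?case
  proof (rule sat_OrI)
    show "A \<union> C \<Turnstile> \<phi>" by (rule Or.IH(1)[OF AB(2) CD(2)])
    show "B \<union> D \<Turnstile> \<psi>" by (rule Or.IH(2)[OF AB(3) CD(3)])
    show "X \<union> Y = (A \<union> C) \<union> (B \<union> D)" using AB CD by blast
  qed
next
  case (Rel \<phi> \<psi>)
  show ?case
  proof (cases "X = {} \<or> Y = {}")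
    case True
    then show ?thesis using Rel.prems by (metis Un_empty_left Un_empty_right)
  next
    case False
    obtain A B where AB: "X = A \<union> B" "A \<Turnstile> \<phi>" "B \<Turnstile> \<psi>" "A \<noteq> {}" "B \<noteq> {}"
      by (rule sat_RelE[OF Rel.prems(1)]) (use False in simp_all)
    obtain C D where CD: "Y = C \<union> D" "C \<Turnstile> \<phi>" "D \<Turnstile> \<psi>"
      by (rule sat_RelE[OF Rel.prems(2)]) (use False in simp_all)
    show ?thesis
    proof (rule sat_RelI)
      show "A \<union> C \<Turnstile> \<phi>" by (rule Rel.IH(1)[OF AB(2) CD(2)])
      show "B \<union> D \<Turnstile> \<psi>" by (rule Rel.IH(2)[OF AB(3) CD(3)])
      show "X \<union> Y = (A \<union> C) \<union> (B \<union> D)" using AB CD by blast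
      show "A \<union> C \<noteq> {}" "B \<union> D \<noteq> {}" using AB(4,5) by simp_all
    qed
  qed
qed auto

lemma sat_Or_singleton: "{v} \<Turnstile> (\<phi> \<^bold>\<or> \<psi>) \<longleftrightarrow> {v} \<Turnstile> \<phi> \<or> {v} \<Turnstile> \<psi>"
proof
  assume "{v} \<Turnstile> (\<phi> \<^bold>\<or> \<psi>)"
  then obtain Y Z where YZ: "{v} = Y \<union> Z" "Y \<Turnstile> \<phi>" "Z \<Turnstile> \<psi>" by (rule sat_OrE)
  then have "Y = {v} \<or> Z = {v}" by blast
  then show "{v} \<Turnstile> \<phi> \<or> {v} \<Turnstile> \<psi>" using YZ by auto
next
  assume "{v} \<Turnstile> \<phi> \<or> {v} \<Turnstile> \<psi>"
  then show "{v} \<Turnstile> (\<phi> \<^bold>\<or> \<psi>)"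
    using sat_OrI[of "{v}" \<phi> "{}" \<psi>] sat_OrI[of "{}" \<phi> "{v}" \<psi>] by auto
qed

lemma emb_flat: "X \<Turnstile> emb \<alpha> \<longleftrightarrow> (\<forall>v\<in>X. {v} \<Turnstile> emb \<alpha>)"
proof (induction \<alpha> arbitrary: X)
  case (COr a b)
  show ?case
  proof
    assume "X \<Turnstile> emb (COr a b)"
    then obtain Y Z where "X = Y \<union> Z" "Y \<Turnstile> emb a" "Z \<Turnstile> emb b"
      unfolding emb.simps by (rule sat_OrE)
    then show "\<forall>v\<in>X. {v} \<Turnstile> emb (COr a b)"
      using COr.IH(1)[of Y] COr.IH(2)[of Z] unfolding emb.simps sat_Or_singleton by blast
  next
    assume *: "\<forall>v\<in>X. {v} \<Turnstile> emb (COr a b)"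
    show "X \<Turnstile> emb (COr a b)"
      unfolding emb.simps
    proof (rule sat_OrI)
      show "{v\<in>X. {v} \<Turnstile> emb a} \<Turnstile> emb a" by (subst COr.IH(1)) simp
      show "{v\<in>X. {v} \<Turnstile> emb b} \<Turnstile> emb b" by (subst COr.IH(2)) simp
      show "X = {v\<in>X. {v} \<Turnstile> emb a} \<union> {v\<in>X. {v} \<Turnstile> emb b}"
        using * unfolding emb.simps sat_Or_singleton by blast
    qed
  qed
next
  case (CAnd a b)
  show ?case using CAnd.IH(1)[of X] CAnd.IH(2)[of X] by auto
next
  case (CNeg a)
  show ?case by simp
qed simp_all

lemma classical_flat: "\<alpha> \<in> classical \<Longrightarrow> X \<Turnstile> \<alpha> \<longleftrightarrow> (\<forall>v\<in>X. {v} \<Turnstile> \<alpha>)"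
  using emb_flat unfolding classical_def by blast

lemma classical_mono: "\<alpha> \<in> classical \<Longrightarrow> X \<Turnstile> \<alpha> \<Longrightarrow> Y \<subseteq> X \<Longrightarrow> Y \<Turnstile> \<alpha>"
  using classical_flat[of \<alpha> X] classical_flat[of \<alpha> Y] by blast

lemma emb_classical [simp]: "emb \<alpha> \<in> classical"
  by (simp add: classical_def)

text \<open>Satisfaction reads an undefined variable as false, so the rules preserve truth in every set of
  partial valuations. Variables that occur only in intermediate formulas of a derivation are thereby
  covered without extending the domain of a team.\<close>

lemma soundness: "\<Gamma> \<turnstile> \<phi> \<Longrightarrow> (\<And>\<gamma>. \<gamma> \<in> \<Gamma> \<Longrightarrow> X \<Turnstile> \<gamma>) \<Longrightarrow> X \<Turnstile> \<phi>"
proof (induction arbitrary: X rule: derives.induct)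
  case (NegI \<Delta> \<alpha>)
  have "\<not> {v} \<Turnstile> emb \<alpha>" if "v \<in> X" for v
  proof
    assume a: "{v} \<Turnstile> emb \<alpha>"
    have "{v} \<Turnstile> \<gamma>" if "\<gamma> \<in> \<Delta> \<union> {emb \<alpha>}" for \<gamma>
      using NegI.hyps(1) NegI.prems that a \<open>v \<in> X\<close> classical_mono[of \<gamma> X "{v}"] by blast
    then have "{v} \<Turnstile> Bot" by (rule NegI.IH)
    then show False by simp
  qed
  then show ?case by simp
next
  case (RAA \<Delta> \<alpha>)
  have "{v} \<Turnstile> emb \<alpha>" if "v \<in> X" for v
  proof (rule ccontr)
    assume a: "\<not> {v} \<Turnstile> emb \<alpha>"
    have "{v} \<Turnstile> \<gamma>" if "\<gamma> \<in> \<Delta> \<union> {Neg \<alpha>}" for \<gamma>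
    proof (cases "\<gamma> \<in> \<Delta>")
      case True
      then show ?thesis
        using RAA.hyps(1) RAA.prems \<open>v \<in> X\<close> classical_mono[of \<gamma> X "{v}"] by blast
    next
      case False
      then show ?thesis using that a by simp
    qed
    then have "{v} \<Turnstile> Bot" by (rule RAA.IH)
    then show False by simp
  qed
  then show ?case using emb_flat by blast
next
  case (NegE \<Gamma> \<alpha> \<phi>)
  have "X \<Turnstile> emb \<alpha>" by (rule NegE.IH(1)) (rule NegE.prems)
  moreover have "X \<Turnstile> Neg \<alpha>" by (rule NegE.IH(2)) (rule NegE.prems)
  ultimately have "X = {}"
    unfolding sat.simps(4) using emb_flat by blast
  then show ?case by simp
next
  case (OrI1 \<Gamma> \<phi> \<psi>)
  show ?case by (rule sat_OrI[of X _ "{}"]) (rule OrI1.IH, rule OrI1.prems, simp_all)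
next
  case (OrI2 \<Gamma> \<phi> \<psi>)
  show ?case by (rule sat_OrI[of "{}" _ X]) (simp, rule OrI2.IH, rule OrI2.prems, simp_all)
next
  case (OrE \<Delta> \<Gamma> \<phi> \<psi> \<chi>)
  have "X \<Turnstile> (\<phi> \<^bold>\<or> \<psi>)" by (rule OrE.IH(1)) (use OrE.prems in blast)
  then obtain Y Z where YZ: "X = Y \<union> Z" "Y \<Turnstile> \<phi>" "Z \<Turnstile> \<psi>" by (rule sat_OrE)
  have \<Delta>: "Y \<Turnstile> \<gamma> \<and> Z \<Turnstile> \<gamma>" if "\<gamma> \<in> \<Delta>" for \<gamma>
    using that OrE.hyps(1) OrE.prems YZ(1) classical_mono[of \<gamma> X] by blast
  have "Y \<Turnstile> \<chi>" by (rule OrE.IH(2)) (use \<Delta> YZ in blast)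
  moreover have "Z \<Turnstile> \<chi>" by (rule OrE.IH(3)) (use \<Delta> YZ in blast)
  ultimately show ?case unfolding YZ(1) by (rule sat_Un)
next
  case (RelI \<Gamma> \<phi> \<psi>)
  have "X \<Turnstile> \<phi>" by (rule RelI.IH(1)) (rule RelI.prems)
  moreover have "X \<Turnstile> \<psi>" by (rule RelI.IH(2)) (rule RelI.prems)
  ultimately show ?case using sat_RelI[of X \<phi> X \<psi> X] by (cases "X = {}") simp_all
next
  case (RelMon \<Delta> \<Gamma> \<phi> \<psi> \<chi>)
  show ?case
  proof (cases "X = {}")
    case False
    have "X \<Turnstile> (\<phi> \<or>\<^sub>r \<psi>)" by (rule RelMon.IH(1)) (use RelMon.prems in blast)
    then obtain Y Z where YZ: "X = Y \<union> Z" "Y \<Turnstile> \<phi>" "Z \<Turnstile> \<psi>" "Y \<noteq> {}" "Z \<noteq> {}"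
      using False by (rule sat_RelE)
    have \<Delta>: "Y \<Turnstile> \<gamma>" if "\<gamma> \<in> \<Delta>" for \<gamma>
      using that RelMon.hyps(1) RelMon.prems YZ(1) classical_mono[of \<gamma> X] by blast
    have "Y \<Turnstile> \<chi>" by (rule RelMon.IH(2)) (use \<Delta> YZ in blast)
    then show ?thesis by (rule sat_RelI[OF _ YZ(3,1,4,5)])
  qed simp
next
  case (RelCom \<Gamma> \<phi> \<psi>)
  show ?case
  proof (cases "X = {}")
    case False
    have "X \<Turnstile> (\<phi> \<or>\<^sub>r \<psi>)" by (rule RelCom.IH) (use RelCom.prems in blast)
    then obtain Y Z where YZ: "X = Y \<union> Z" "Y \<Turnstile> \<phi>" "Z \<Turnstile> \<psi>" "Y \<noteq> {}" "Z \<noteq> {}"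
      using False by (rule sat_RelE)
    show ?thesis by (rule sat_RelI[OF YZ(3,2)]) (use YZ in blast)+
  qed simp
next
  case (RelAss \<Gamma> \<phi> \<psi> \<chi>)
  show ?case
  proof (cases "X = {}")
    case False
    have "X \<Turnstile> (\<phi> \<or>\<^sub>r (\<psi> \<or>\<^sub>r \<chi>))" by (rule RelAss.IH) (use RelAss.prems in blast)
    then obtain A D where A: "X = A \<union> D" "A \<Turnstile> \<phi>" "D \<Turnstile> (\<psi> \<or>\<^sub>r \<chi>)" "A \<noteq> {}" "D \<noteq> {}"
      using False by (rule sat_RelE)
    obtain B C where B: "D = B \<union> C" "B \<Turnstile> \<psi>" "C \<Turnstile> \<chi>" "B \<noteq> {}" "C \<noteq> {}"
      using A(3,5) by (rule sat_RelE)
    have "A \<union> B \<Turnstile> (\<phi> \<or>\<^sub>r \<psi>)" by (rule sat_RelI[OF A(2) B(2)]) (use A B in blast)+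
    then show ?thesis by (rule sat_RelI[OF _ B(3)]) (use A B in blast)+
  qed simp
next
  case (OrERel \<Gamma> \<phi> \<psi> \<chi>)
  have "X \<Turnstile> (\<phi> \<^bold>\<or> \<psi>)" by (rule OrERel.IH(1)) (use OrERel.prems in blast)
  then obtain Y Z where YZ: "X = Y \<union> Z" "Y \<Turnstile> \<phi>" "Z \<Turnstile> \<psi>" by (rule sat_OrE)
  then consider "X \<Turnstile> \<phi>" | "X \<Turnstile> \<psi>" | "X \<Turnstile> (\<phi> \<or>\<^sub>r \<psi>)"
    using sat_RelI[of Y \<phi> Z \<psi> X] by (metis Un_empty_left Un_empty_right)
  then show ?case
  proof cases
    case 1
    then show ?thesis by (intro OrERel.IH(2)) (use OrERel.prems in blast)
  next
    case 2
    then show ?thesis by (intro OrERel.IH(3)) (use OrERel.prems in blast)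
  next
    case 3
    then show ?thesis by (intro OrERel.IH(4)) (use OrERel.prems in blast)
  qed
next
  case (RelOrTr \<Gamma> \<phi> \<psi>)
  show ?case
  proof (cases "X = {}")
    case False
    have "X \<Turnstile> (\<phi> \<or>\<^sub>r \<psi>)" by (rule RelOrTr.IH) (use RelOrTr.prems in blast)
    then obtain Y Z where "X = Y \<union> Z" "Y \<Turnstile> \<phi>" "Z \<Turnstile> \<psi>"
      using False by (rule sat_RelE)
    then show ?thesis by (intro sat_OrI[of Y _ Z])
  qed simp
next
  case (RelBotE \<Gamma> \<phi> \<psi>)
  have "X \<Turnstile> (\<phi> \<or>\<^sub>r Bot)" by (rule RelBotE.IH) (use RelBotE.prems in blast)
  then have "X = {}" by auto
  then show ?case by simp
next
  case (DstrRelOr \<Gamma> \<phi> \<psi> \<chi>)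
  show ?case
  proof (cases "X = {}")
    case False
    have "X \<Turnstile> (\<phi> \<or>\<^sub>r (\<psi> \<^bold>\<or> \<chi>))" by (rule DstrRelOr.IH) (use DstrRelOr.prems in blast)
    then obtain A D where A: "X = A \<union> D" "A \<Turnstile> \<phi>" "D \<Turnstile> (\<psi> \<^bold>\<or> \<chi>)" "A \<noteq> {}" "D \<noteq> {}"
      using False by (rule sat_RelE)
    obtain B C where B: "D = B \<union> C" "B \<Turnstile> \<psi>" "C \<Turnstile> \<chi>"
      using A(3) by (rule sat_OrE)
    \<comment> \<open>One of \<open>B\<close>, \<open>C\<close> may be empty; the corresponding disjunct is then witnessed by the
      empty team.\<close>
    define Y where "Y = (if B = {} then {} else A \<union> B)"
    define Z where "Z = (if C = {} then {} else A \<union> C)"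
    show ?thesis
    proof (rule sat_OrI)
      show "Y \<Turnstile> (\<phi> \<or>\<^sub>r \<psi>)"
        using sat_RelI[OF A(2) B(2)] A(4) by (simp add: Y_def del: sat.simps)
      show "Z \<Turnstile> (\<phi> \<or>\<^sub>r \<chi>)"
        using sat_RelI[OF A(2) B(3)] A(4) by (simp add: Z_def del: sat.simps)
      show "X = Y \<union> Z" using A B by (auto simp: Y_def Z_def)
    qed
  qed simp
next
  case (AndI \<Gamma> \<phi> \<psi>)
  have "X \<Turnstile> \<phi>" "X \<Turnstile> \<psi>"
    by (rule AndI.IH, use AndI.prems in blast)+
  then show ?case by simp
next
  case (AndE1 \<Gamma> \<phi> \<psi>)
  have "X \<Turnstile> (\<phi> \<^bold>\<and> \<psi>)" by (rule AndE1.IH) (rule AndE1.prems)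
  then show ?case by simp
next
  case (AndE2 \<Gamma> \<phi> \<psi>)
  have "X \<Turnstile> (\<phi> \<^bold>\<and> \<psi>)" by (rule AndE2.IH) (rule AndE2.prems)
  then show ?case by simp
next
  case (Assm \<phi> \<Gamma>)
  then show ?case by blast
next
  case (Weak \<Gamma> \<phi> \<Gamma>')
  show ?case by (rule Weak.IH) (use Weak.prems in blast)
next
  case (TopI \<Gamma>)
  show ?case by simp
qed

section \<open>Derived rules\<close>

lemma weaken: "\<Gamma> \<turnstile> \<phi> \<Longrightarrow> \<Gamma> \<subseteq> \<Gamma>' \<Longrightarrow> \<Gamma>' \<turnstile> \<phi>"
  using Weak[of \<Gamma> \<phi> \<Gamma>'] by (simp add: Un_absorb1)

lemma ex_falso: assumes "\<Gamma> \<turnstile> Bot" shows "\<Gamma> \<turnstile> \<phi>"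
proof -
  have "{} \<turnstile> Neg CBot" by (rule NegI) (simp_all add: Assm)
  then have "\<Gamma> \<turnstile> Neg CBot" by (rule weaken) simp
  then show ?thesis using NegE[of \<Gamma> CBot] assms by simp
qed

text \<open>There is no implication through which to route a cut. Instead \<open>\<phi>\<close> is padded to
  \<open>\<phi> \<^bold>\<or> Bot\<close>: in the rule \<open>OrERel\<close>, which admits arbitrary side assumptions, the two extra cases
  \<open>Bot\<close> and \<open>\<phi> \<or>\<^sub>r Bot\<close> are both contradictory.\<close>

lemma cut:
  assumes "\<Gamma> \<turnstile> \<phi>" "\<Gamma> \<union> {\<phi>} \<turnstile> \<chi>"
  shows "\<Gamma> \<turnstile> \<chi>"
proof (rule OrERel)
  show "\<Gamma> \<turnstile> (\<phi> \<^bold>\<or> Bot)" using assms(1) by (rule OrI1)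
  show "\<Gamma> \<union> {Bot} \<turnstile> \<chi>" by (rule ex_falso) (simp add: Assm)
  show "\<Gamma> \<union> {\<phi> \<or>\<^sub>r Bot} \<turnstile> \<chi>" by (rule RelBotE[of _ \<phi>]) (simp add: Assm)
qed fact

lemma cut1: "\<Gamma> \<turnstile> \<phi> \<Longrightarrow> {\<phi>} \<turnstile> \<chi> \<Longrightarrow> \<Gamma> \<turnstile> \<chi>"
  by (rule cut, assumption, erule weaken) simp

lemma refl1: "{\<phi>} \<turnstile> \<phi>"
  by (rule Assm) simp

lemma trans1 [trans]: "{\<phi>} \<turnstile> \<psi> \<Longrightarrow> {\<psi>} \<turnstile> \<chi> \<Longrightarrow> {\<phi>} \<turnstile> \<chi>"
  by (rule cut1)

lemma replace: "\<Gamma> \<union> {\<psi>} \<turnstile> \<chi> \<Longrightarrow> {\<phi>} \<turnstile> \<psi> \<Longrightarrow> \<Gamma> \<union> {\<phi>} \<turnstile> \<chi>"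
proof (rule cut[of _ \<psi>])
  show "{\<phi>} \<turnstile> \<psi> \<Longrightarrow> \<Gamma> \<union> {\<phi>} \<turnstile> \<psi>" by (erule weaken) simp
  show "\<Gamma> \<union> {\<psi>} \<turnstile> \<chi> \<Longrightarrow> \<Gamma> \<union> {\<phi>} \<union> {\<psi>} \<turnstile> \<chi>" by (erule weaken) auto
qed

text \<open>Up to provable equivalence, formulas form a preorder in which the tensor disjunction is a join, while
  relevant disjunction is only a monotone, commutative, associative and idempotent operation:
  \<open>\<phi>\<close> need not imply \<open>\<phi> \<or>\<^sub>r \<psi>\<close>.\<close>

lemma Or_least: "{\<phi>} \<turnstile> \<chi> \<Longrightarrow> {\<psi>} \<turnstile> \<chi> \<Longrightarrow> {\<phi> \<^bold>\<or> \<psi>} \<turnstile> \<chi>"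
  using OrE[of "{}" "{\<phi> \<^bold>\<or> \<psi>}" \<phi> \<psi> \<chi>] refl1[of "\<phi> \<^bold>\<or> \<psi>"] by simp

lemma Or_mono: "{\<phi>} \<turnstile> \<phi>' \<Longrightarrow> {\<psi>} \<turnstile> \<psi>' \<Longrightarrow> {\<phi> \<^bold>\<or> \<psi>} \<turnstile> (\<phi>' \<^bold>\<or> \<psi>')"
  by (intro Or_least OrI1 OrI2)

lemma Rel_comm: "{\<phi> \<or>\<^sub>r \<psi>} \<turnstile> (\<psi> \<or>\<^sub>r \<phi>)"
  by (rule RelCom) (rule refl1)

lemma Rel_mono1: "{\<phi>} \<turnstile> \<chi> \<Longrightarrow> {\<phi> \<or>\<^sub>r \<psi>} \<turnstile> (\<chi> \<or>\<^sub>r \<psi>)"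
  using RelMon[of "{}" "{\<phi> \<or>\<^sub>r \<psi>}" \<phi> \<psi> \<chi>] refl1[of "\<phi> \<or>\<^sub>r \<psi>"] by simp

lemma Rel_mono:
  assumes "{\<phi>} \<turnstile> \<phi>'" "{\<psi>} \<turnstile> \<psi>'"
  shows "{\<phi> \<or>\<^sub>r \<psi>} \<turnstile> (\<phi>' \<or>\<^sub>r \<psi>')"
  using Rel_mono1[OF assms(1)] Rel_comm Rel_mono1[OF assms(2)] Rel_comm
  by (metis cut1)

lemma Rel_assoc: "{\<phi> \<or>\<^sub>r (\<psi> \<or>\<^sub>r \<chi>)} \<turnstile> ((\<phi> \<or>\<^sub>r \<psi>) \<or>\<^sub>r \<chi>)"
  by (rule RelAss) (rule refl1)

lemma Rel_assoc': "{(\<phi> \<or>\<^sub>r \<psi>) \<or>\<^sub>r \<chi>} \<turnstile> (\<phi> \<or>\<^sub>r (\<psi> \<or>\<^sub>r \<chi>))"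
proof -
  have "{(\<phi> \<or>\<^sub>r \<psi>) \<or>\<^sub>r \<chi>} \<turnstile> (\<chi> \<or>\<^sub>r (\<psi> \<or>\<^sub>r \<phi>))"
    by (meson Rel_comm Rel_mono refl1 trans1)
  also have "{(\<chi> \<or>\<^sub>r (\<psi> \<or>\<^sub>r \<phi>))} \<turnstile> ((\<chi> \<or>\<^sub>r \<psi>) \<or>\<^sub>r \<phi>)" by (rule Rel_assoc)
  also have "{(\<chi> \<or>\<^sub>r \<psi>) \<or>\<^sub>r \<phi>} \<turnstile> (\<phi> \<or>\<^sub>r (\<psi> \<or>\<^sub>r \<chi>))"
    by (meson Rel_comm Rel_mono refl1 trans1)
  finally show ?thesis .
qed

lemma Rel_idem: "{\<phi> \<or>\<^sub>r \<phi>} \<turnstile> \<phi>"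
  by (rule cut1[OF RelOrTr[OF refl1]]) (intro Or_least refl1)

lemma Rel_dup: "{\<phi>} \<turnstile> (\<phi> \<or>\<^sub>r \<phi>)"
  by (intro RelI refl1)

section \<open>Iterated disjunctions\<close>

fun rels :: "'p fm list \<Rightarrow> 'p fm" where
  "rels [] = Bot"
| "rels [\<phi>] = \<phi>"
| "rels (\<phi> # \<psi> # xs) = \<phi> \<or>\<^sub>r rels (\<psi> # xs)"

primrec ors :: "'p fm list \<Rightarrow> 'p fm" where
  "ors [] = Bot"
| "ors (\<phi> # xs) = \<phi> \<^bold>\<or> ors xs"

lemma rels_Cons: "xs \<noteq> [] \<Longrightarrow> rels (\<phi> # xs) = \<phi> \<or>\<^sub>r rels xs"
  by (cases xs) auto

lemma rels_append:
  assumes "xs \<noteq> []" "ys \<noteq> []"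
  shows "{rels (xs @ ys)} \<turnstile> (rels xs \<or>\<^sub>r rels ys)" "{rels xs \<or>\<^sub>r rels ys} \<turnstile> rels (xs @ ys)"
  using assms
proof (induction xs rule: list_nonempty_induct)
  case (single x)
  { case 1 then show ?case by (simp add: rels_Cons refl1) }
  { case 2 then show ?case by (simp add: rels_Cons refl1) }
next
  case (cons x xs)
  { case 1
    then have "{x \<or>\<^sub>r rels (xs @ ys)} \<turnstile> (x \<or>\<^sub>r (rels xs \<or>\<^sub>r rels ys))"
      using cons by (intro Rel_mono refl1) simp
    then show ?case using cons.hyps by (auto simp: rels_Cons intro: trans1 Rel_assoc) }
  { case 2
    then have "{x \<or>\<^sub>r (rels xs \<or>\<^sub>r rels ys)} \<turnstile> (x \<or>\<^sub>r rels (xs @ ys))"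
      using cons by (intro Rel_mono refl1) simp
    then show ?case using cons.hyps by (auto simp: rels_Cons intro: trans1 Rel_assoc') }
qed

text \<open>The semilattice laws of the relevant disjunction make \<open>rels xs\<close> depend on \<open>set xs\<close> only. This
  lemma and the next two prove it; they replace all later rearrangements by an equality of sets.\<close>

lemma rels_absorb:
  "x \<in> set xs \<Longrightarrow> {x \<or>\<^sub>r rels xs} \<turnstile> rels xs"
  "x \<in> set xs \<Longrightarrow> {rels xs} \<turnstile> (x \<or>\<^sub>r rels xs)"
proof (induction xs rule: rels.induct)
  case 1
  { case 1 then show ?case by simp }
  { case 2 then show ?case by simp }
next
  case (2 y)
  { case 1 then show ?case by (simp add: Rel_idem) }
  { case 2 then show ?case by (simp add: Rel_dup) }
next
  case (3 y z zs)
  let ?r = "rels (z # zs)"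
  { case 1
    show ?case
    proof (cases "x = y")
      case True
      have "{y \<or>\<^sub>r (y \<or>\<^sub>r ?r)} \<turnstile> (y \<or>\<^sub>r ?r)"
        using Rel_assoc Rel_mono1[OF Rel_idem] by (rule trans1)
      then show ?thesis using True by simp
    next
      case False
      then have "{x \<or>\<^sub>r ?r} \<turnstile> ?r" using 1 "3.IH" by auto
      then have "{y \<or>\<^sub>r (x \<or>\<^sub>r ?r)} \<turnstile> (y \<or>\<^sub>r ?r)" by (intro Rel_mono refl1)
      moreover have "{x \<or>\<^sub>r (y \<or>\<^sub>r ?r)} \<turnstile> (y \<or>\<^sub>r (x \<or>\<^sub>r ?r))"
        by (meson Rel_comm Rel_mono1 Rel_assoc Rel_assoc' trans1)
      ultimately show ?thesis by (auto intro: trans1)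
    qed }
  { case 2
    show ?case
    proof (cases "x = y")
      case True
      have "{y \<or>\<^sub>r ?r} \<turnstile> (y \<or>\<^sub>r (y \<or>\<^sub>r ?r))"
        using Rel_mono1[OF Rel_dup] Rel_assoc' by (rule trans1)
      then show ?thesis using True by simp
    next
      case False
      then have "{?r} \<turnstile> (x \<or>\<^sub>r ?r)" using 2 "3.IH" by auto
      then have "{y \<or>\<^sub>r ?r} \<turnstile> (y \<or>\<^sub>r (x \<or>\<^sub>r ?r))" by (intro Rel_mono refl1)
      moreover have "{y \<or>\<^sub>r (x \<or>\<^sub>r ?r)} \<turnstile> (x \<or>\<^sub>r (y \<or>\<^sub>r ?r))"
        by (meson Rel_comm Rel_mono1 Rel_assoc Rel_assoc' trans1)
      ultimately show ?thesis by (auto intro: trans1)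
    qed }
qed

lemma rels_absorb_list:
  assumes "xs \<noteq> []"
  shows "set ys \<subseteq> set xs \<Longrightarrow> {rels (ys @ xs)} \<turnstile> rels xs"
    and "set ys \<subseteq> set xs \<Longrightarrow> {rels xs} \<turnstile> rels (ys @ xs)"
proof (induction ys)
  case Nil
  { case 1 then show ?case by (simp add: refl1) }
  { case 2 then show ?case by (simp add: refl1) }
next
  case (Cons y ys)
  { case 1
    then have "{y \<or>\<^sub>r rels (ys @ xs)} \<turnstile> (y \<or>\<^sub>r rels xs)"
      using Cons by (intro Rel_mono refl1) simp
    then show ?case using 1 assms rels_absorb(1)[of y xs] by (auto simp: rels_Cons intro: trans1) }
  { case 2
    then have "{y \<or>\<^sub>r rels xs} \<turnstile> (y \<or>\<^sub>r rels (ys @ xs))"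
      using Cons by (intro Rel_mono refl1) simp
    then show ?case using 2 assms rels_absorb(2)[of y xs] by (auto simp: rels_Cons intro: trans1) }
qed

lemma rels_set_cong:
  assumes "set xs = set ys"
  shows "{rels xs} \<turnstile> rels ys"
proof (cases "xs = []")
  case True
  then show ?thesis using assms by (simp add: refl1)
next
  case False
  then have ne: "ys \<noteq> []" using assms by auto
  have "{rels xs} \<turnstile> rels (ys @ xs)" using False assms by (intro rels_absorb_list) auto
  also have "{rels (ys @ xs)} \<turnstile> (rels ys \<or>\<^sub>r rels xs)" using False ne by (rule rels_append(1)[rotated])
  also have "{rels ys \<or>\<^sub>r rels xs} \<turnstile> (rels xs \<or>\<^sub>r rels ys)" by (rule Rel_comm)
  also have "{rels xs \<or>\<^sub>r rels ys} \<turnstile> rels (xs @ ys)" using False ne by (rule rels_append(2))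
  also have "{rels (xs @ ys)} \<turnstile> rels ys" using ne assms by (intro rels_absorb_list) auto
  finally show ?thesis .
qed

lemma rels_imp_ors: "{rels xs} \<turnstile> ors xs"
proof (induction xs rule: rels.induct)
  case (3 x y ys)
  have "{x \<or>\<^sub>r rels (y # ys)} \<turnstile> (x \<^bold>\<or> rels (y # ys))" by (rule RelOrTr) (rule refl1)
  also have "{x \<^bold>\<or> rels (y # ys)} \<turnstile> (x \<^bold>\<or> ors (y # ys))" using 3 by (intro Or_mono refl1)
  finally show ?case by simp
qed (auto intro: refl1 OrI1)

text \<open>The formula \<open>x \<or>\<^sub>r Top\<close> says that \<open>x\<close> holds in a nonempty subteam.\<close>

lemma rels_imp_Rel_Top: 
  assumes "x \<in> set xs" shows "{rels xs} \<turnstile> (x \<or>\<^sub>r Top)"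
proof -
  have "{x \<or>\<^sub>r rels xs} \<turnstile> (x \<or>\<^sub>r Top)" by (intro Rel_mono refl1 TopI)
  then show ?thesis using rels_absorb(2)[OF assms] by (rule trans1[rotated])
qed

lemma ors_upper: "x \<in> set xs \<Longrightarrow> {x} \<turnstile> ors xs"
  by (induction xs) (auto intro: OrI1 OrI2 refl1)

lemma ors_least: "(\<And>x. x \<in> set xs \<Longrightarrow> {x} \<turnstile> \<chi>) \<Longrightarrow> {ors xs} \<turnstile> \<chi>"
  by (induction xs) (auto intro: Or_least ex_falso refl1)

lemma Rel_ors_least: "(\<And>x. x \<in> set xs \<Longrightarrow> {\<phi> \<or>\<^sub>r x} \<turnstile> \<chi>) \<Longrightarrow> {\<phi> \<or>\<^sub>r ors xs} \<turnstile> \<chi>"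
proof (induction xs)
  case Nil
  show ?case by (simp add: RelBotE[OF refl1])
next
  case (Cons x xs)
  have "{\<phi> \<or>\<^sub>r (x \<^bold>\<or> ors xs)} \<turnstile> ((\<phi> \<or>\<^sub>r x) \<^bold>\<or> (\<phi> \<or>\<^sub>r ors xs))"
    by (rule DstrRelOr) (rule refl1)
  also have "{(\<phi> \<or>\<^sub>r x) \<^bold>\<or> (\<phi> \<or>\<^sub>r ors xs)} \<turnstile> \<chi>"
  proof (rule Or_least)
    show "{\<phi> \<or>\<^sub>r x} \<turnstile> \<chi>" by (rule Cons.prems) simp
    show "{\<phi> \<or>\<^sub>r ors xs} \<turnstile> \<chi>" by (rule Cons.IH) (rule Cons.prems, simp)
  qed
  finally show ?case by simp
qed

lemma rels_Rel_ors: "{rels xs \<or>\<^sub>r ors xs} \<turnstile> rels xs"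
  by (rule Rel_ors_least) (rule trans1[OF Rel_comm rels_absorb(1)])

lemma ors_classical: "set xs \<subseteq> classical \<Longrightarrow> ors xs \<in> classical"
proof (induction xs)
  case Nil
  show ?case using emb_classical[of CBot] by simp
next
  case (Cons x xs)
  then obtain a b where "x = emb a" "ors xs = emb b" by (auto simp: classical_def)
  then show ?case using emb_classical[of "COr a b"] by simp
qed

lemma And_classical: "\<alpha> \<in> classical \<Longrightarrow> \<beta> \<in> classical \<Longrightarrow> (\<alpha> \<^bold>\<and> \<beta>) \<in> classical"
  by (auto simp: classical_def) (metis emb.simps(5) rangeI)

lemma RelMon_classical:
  assumes "\<beta> \<in> classical" "\<Gamma> \<turnstile> \<beta>" "\<Gamma> \<turnstile> (\<phi> \<or>\<^sub>r \<psi>)" "{\<beta>, \<phi>} \<turnstile> \<chi>"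
  shows "\<Gamma> \<turnstile> (\<chi> \<or>\<^sub>r \<psi>)"
proof (rule cut[OF assms(2)], rule RelMon[OF _ assms(3)])
  show "{\<beta>} \<subseteq> classical" using assms(1) by simp
  show "{\<beta>} \<union> {\<phi>} \<turnstile> \<chi>" using assms(4) by (simp add: insert_commute)
qed

text \<open>The converse of \<open>rels_imp_ors\<close> and \<open>rels_imp_Rel_Top\<close>. Since \<open>ors xs\<close> is classical, it
  may replace \<open>Top\<close> in each \<open>x \<or>\<^sub>r Top\<close>. Joining the resulting formulas by \<open>RelI\<close> and
  contracting the copies of \<open>ors xs\<close> gives \<open>rels xs \<or>\<^sub>r ors xs\<close>. Distributing over \<open>ors xs\<close>
  leaves \<open>rels xs \<or>\<^sub>r x\<close> for the single members \<open>x\<close>, and these are absorbed.\<close>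

lemma rels_intro:
  assumes ne: "xs \<noteq> []" and cl: "set xs \<subseteq> classical"
    and o: "\<Gamma> \<turnstile> ors xs" and d: "\<And>x. x \<in> set xs \<Longrightarrow> \<Gamma> \<turnstile> (x \<or>\<^sub>r Top)"
  shows "\<Gamma> \<turnstile> rels xs"
proof -
  have x: "\<Gamma> \<turnstile> (ors xs \<or>\<^sub>r x)" if "x \<in> set xs" for x
    using RelMon_classical[OF ors_classical[OF cl] o RelCom[OF d[OF that]]]
    by (simp add: Assm)
  have "\<Gamma> \<turnstile> (ors xs \<or>\<^sub>r rels ys)" if "ys \<noteq> []" "set ys \<subseteq> set xs" for ys
    using that
  proof (induction ys rule: list_nonempty_induct)
    case (single y)
    then show ?case using x by simp
  next
    case (cons y ys)
    let ?o = "ors xs"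
    have "\<Gamma> \<turnstile> rels ([?o, y] @ [?o, rels ys])"
      using RelI[OF x[of y] cons.IH] cons.prems
        rels_append(2)[of "[?o, y]" "[?o, rels ys]"] by (auto intro: cut1)
    then have "\<Gamma> \<turnstile> rels [?o, y, rels ys]"
      by (rule cut1) (rule rels_set_cong, auto)
    then show ?case using cons.hyps by (simp add: rels_Cons)
  qed
  from this[OF ne] have "\<Gamma> \<turnstile> (rels xs \<or>\<^sub>r ors xs)" by (auto intro: RelCom)
  then show ?thesis by (rule cut1) (simp add: rels_Rel_ors)
qed

section \<open>Maximal sets and classical completeness\<close>

lemma finite_discharge:
  assumes "\<exists>G\<subseteq>\<Gamma> \<union> {\<phi>}. finite G \<and> G \<turnstile> \<chi>"
  shows "\<exists>G\<subseteq>\<Gamma>. finite G \<and> G \<union> {\<phi>} \<turnstile> \<chi>"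
proof -
  obtain G where "G \<subseteq> \<Gamma> \<union> {\<phi>}" "finite G" "G \<turnstile> \<chi>" using assms by blast
  then have "G - {\<phi>} \<subseteq> \<Gamma>" "finite (G - {\<phi>})" "(G - {\<phi>}) \<union> {\<phi>} \<turnstile> \<chi>"
    by (auto elim: weaken)
  then show ?thesis by blast
qed

text \<open>The classicality conditions on \<open>\<Delta>\<close> are inherited by subsets, so every rule can be applied to
  finite parts of its contexts.\<close>

lemma derives_finite: "\<Gamma> \<turnstile> \<phi> \<Longrightarrow> \<exists>G\<subseteq>\<Gamma>. finite G \<and> G \<turnstile> \<phi>"
proof (induction rule: derives.induct)
  case (Assm \<phi> \<Gamma>)
  then show ?case using refl1 by (intro exI[of _ "{\<phi>}"]) auto
next
  case (NegI \<Delta> \<alpha>)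
  then obtain G where G: "G \<subseteq> \<Delta>" "finite G" "G \<union> {emb \<alpha>} \<turnstile> Bot" using finite_discharge[OF NegI.IH] by blast
  then have "G \<subseteq> classical" using NegI.hyps by blast
  then show ?case using derives.NegI[OF _ G(3)] G(1,2) by blast
next
  case (RAA \<Delta> \<alpha>)
  then obtain G where G: "G \<subseteq> \<Delta>" "finite G" "G \<union> {Neg \<alpha>} \<turnstile> Bot" using finite_discharge[OF RAA.IH] by blast
  then have "G \<subseteq> classical" using RAA.hyps by blast
  then show ?case using derives.RAA[OF _ G(3)] G(1,2) by blast
next
  case (NegE \<Gamma> \<alpha> \<phi>)
  then obtain G H where G: "G \<subseteq> \<Gamma>" "finite G" "G \<turnstile> emb \<alpha>" and H: "H \<subseteq> \<Gamma>" "finite H" "H \<turnstile> Neg \<alpha>"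
    by blast
  have "G \<union> H \<turnstile> \<phi>"
    by (rule derives.NegE[of _ \<alpha>]) (use G(3) H(3) in \<open>auto elim: weaken\<close>)
  then show ?case using G H by (intro exI[of _ "G \<union> H"]) auto
next
  case (AndI \<Gamma> \<phi> \<psi>)
  then obtain G H where G: "G \<subseteq> \<Gamma>" "finite G" "G \<turnstile> \<phi>" and H: "H \<subseteq> \<Gamma>" "finite H" "H \<turnstile> \<psi>"
    by blast
  have "G \<union> H \<turnstile> (\<phi> \<^bold>\<and> \<psi>)"
    by (rule derives.AndI) (use G(3) H(3) in \<open>auto elim: weaken\<close>)
  then show ?case using G H by (intro exI[of _ "G \<union> H"]) auto
next
  case (RelI \<Gamma> \<phi> \<psi>)
  then obtain G H where G: "G \<subseteq> \<Gamma>" "finite G" "G \<turnstile> \<phi>" and H: "H \<subseteq> \<Gamma>" "finite H" "H \<turnstile> \<psi>"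
    by blast
  have "G \<union> H \<turnstile> (\<phi> \<or>\<^sub>r \<psi>)"
    by (rule derives.RelI) (use G(3) H(3) in \<open>auto elim: weaken\<close>)
  then show ?case using G H by (intro exI[of _ "G \<union> H"]) auto
next
  case (OrE \<Delta> \<Gamma> \<phi> \<psi> \<chi>)
  obtain G where G: "G \<subseteq> \<Gamma>" "finite G" "G \<turnstile> (\<phi> \<^bold>\<or> \<psi>)" using OrE.IH(1) by blast
  obtain D where D: "D \<subseteq> \<Delta>" "finite D" "D \<union> {\<phi>} \<turnstile> \<chi>"
    using finite_discharge[OF OrE.IH(2)] by blast
  obtain E where E: "E \<subseteq> \<Delta>" "finite E" "E \<union> {\<psi>} \<turnstile> \<chi>"
    using finite_discharge[OF OrE.IH(3)] by blast
  have "G \<union> (D \<union> E) \<turnstile> \<chi>"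
  proof (rule derives.OrE[OF _ G(3)])
    show "D \<union> E \<subseteq> classical" using D E OrE.hyps by blast
    show "D \<union> E \<union> {\<phi>} \<turnstile> \<chi>" using D(3) by (rule weaken) auto
    show "D \<union> E \<union> {\<psi>} \<turnstile> \<chi>" using E(3) by (rule weaken) auto
  qed
  then show ?case using G D E by (intro exI[of _ "G \<union> (D \<union> E)"]) auto
next
  case (RelMon \<Delta> \<Gamma> \<phi> \<psi> \<chi>)
  obtain G where G: "G \<subseteq> \<Gamma>" "finite G" "G \<turnstile> (\<phi> \<or>\<^sub>r \<psi>)" using RelMon.IH(1) by blast
  obtain D where D: "D \<subseteq> \<Delta>" "finite D" "D \<union> {\<phi>} \<turnstile> \<chi>"
    using finite_discharge[OF RelMon.IH(2)] by blast
  have "G \<union> D \<turnstile> (\<chi> \<or>\<^sub>r \<psi>)"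
    by (rule derives.RelMon[OF _ G(3) D(3)]) (use D RelMon.hyps in blast)
  then show ?case using G D by (intro exI[of _ "G \<union> D"]) auto
next
  case (OrERel \<Gamma> \<phi> \<psi> \<chi>)
  obtain G where G: "G \<subseteq> \<Gamma>" "finite G" "G \<turnstile> (\<phi> \<^bold>\<or> \<psi>)" using OrERel.IH(1) by blast
  obtain D where D: "D \<subseteq> \<Gamma>" "finite D" "D \<union> {\<phi>} \<turnstile> \<chi>"
    using finite_discharge[OF OrERel.IH(2)] by blast
  obtain E where E: "E \<subseteq> \<Gamma>" "finite E" "E \<union> {\<psi>} \<turnstile> \<chi>"
    using finite_discharge[OF OrERel.IH(3)] by blast
  obtain F where F: "F \<subseteq> \<Gamma>" "finite F" "F \<union> {\<phi> \<or>\<^sub>r \<psi>} \<turnstile> \<chi>"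
    using finite_discharge[OF OrERel.IH(4)] by blast
  let ?U = "G \<union> D \<union> E \<union> F"
  have "?U \<turnstile> \<chi>"
  proof (rule derives.OrERel)
    show "?U \<turnstile> (\<phi> \<^bold>\<or> \<psi>)" using G(3) by (rule weaken) auto
    show "?U \<union> {\<phi>} \<turnstile> \<chi>" using D(3) by (rule weaken) auto
    show "?U \<union> {\<psi>} \<turnstile> \<chi>" using E(3) by (rule weaken) auto
    show "?U \<union> {\<phi> \<or>\<^sub>r \<psi>} \<turnstile> \<chi>" using F(3) by (rule weaken) auto
  qed
  then show ?case using G D E F by (intro exI[of _ ?U]) auto
next
  case (AndE1)
  then show ?case using derives.AndE1 by metis
next
  case (AndE2)
  then show ?case using derives.AndE2 by metis
next
  case (OrI1)
  then show ?case using derives.OrI1 by metis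
next
  case (OrI2)
  then show ?case using derives.OrI2 by metis
next
  case (RelCom)
  then show ?case using derives.RelCom by metis
next
  case (RelAss)
  then show ?case using derives.RelAss by metis
next
  case (RelOrTr)
  then show ?case using derives.RelOrTr by metis
next
  case (RelBotE)
  then show ?case using derives.RelBotE by metis
next
  case (DstrRelOr)
  then show ?case using derives.DstrRelOr by metis
next
  case (Weak \<Gamma> \<phi> \<Gamma>')
  then show ?case by (metis sup.coboundedI1)
next
  case (TopI \<Gamma>)
  show ?case using derives.TopI by (intro exI[of _ "{}"]) simp
qed

text \<open>The bound \<open>U\<close> lets the same construction yield maximal classical sets, to which the rules with a
  classical context still apply, and maximal sets of arbitrary formulas.\<close>

lemma lindenbaum:
  assumes "\<Gamma> \<subseteq> U" "\<not> \<Gamma> \<turnstile> \<chi>"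
  obtains M where "\<Gamma> \<subseteq> M" "M \<subseteq> U" "\<not> M \<turnstile> \<chi>" "\<forall>\<phi>\<in>U - M. M \<union> {\<phi>} \<turnstile> \<chi>"
proof -
  let ?A = "{M. \<Gamma> \<subseteq> M \<and> M \<subseteq> U \<and> \<not> M \<turnstile> \<chi>}"
  have "\<exists>M\<in>?A. \<forall>N\<in>?A. M \<subseteq> N \<longrightarrow> N = M"
  proof (rule subset_Zorn_nonempty)
    show "?A \<noteq> {}" using assms by blast
  next
    fix C assume C: "C \<noteq> {}" "subset.chain ?A C"
    then have sub: "C \<subseteq> ?A" by (simp add: subset.chain_def)
    have "\<not> \<Union>C \<turnstile> \<chi>"
    proof
      assume "\<Union>C \<turnstile> \<chi>"
      then obtain G where G: "G \<subseteq> \<Union>C" "finite G" "G \<turnstile> \<chi>" using derives_finite by blast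
      then obtain M where "M \<in> C" "G \<subseteq> M" using finite_subset_Union_chain[OF G(2,1) C] by blast
      then have "M \<turnstile> \<chi>" using weaken[OF G(3)] by simp
      then show False using \<open>M \<in> C\<close> sub by blast
    qed
    then show "\<Union>C \<in> ?A" using C(1) sub by blast
  qed
  then obtain M where A: "M \<in> ?A" and max: "\<forall>N\<in>?A. M \<subseteq> N \<longrightarrow> N = M" by (rule bexE)
  from A have M: "\<Gamma> \<subseteq> M" "M \<subseteq> U" "\<not> M \<turnstile> \<chi>" by simp_all
  have "M \<union> {\<phi>} \<turnstile> \<chi>" if \<phi>: "\<phi> \<in> U - M" for \<phi>
  proof (rule ccontr)
    assume "\<not> M \<union> {\<phi>} \<turnstile> \<chi>"
    then have "M \<union> {\<phi>} \<in> ?A" using M(1,2) \<phi> by blast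
    then have "M \<union> {\<phi>} = M" by (rule max[rule_format, OF _ Un_upper1])
    then show False using \<phi> by blast
  qed
  then have "\<forall>\<phi>\<in>U - M. M \<union> {\<phi>} \<turnstile> \<chi>" by (rule ballI)
  with M show ?thesis by (rule that)
qed

text \<open>In a maximal consistent set \<open>M\<close> of classical formulas every rule is applicable, since \<open>M\<close>
  itself qualifies as the classical context; this gives the usual truth lemma.\<close>

lemma classical_model:
  assumes "\<Delta> \<subseteq> classical" "\<not> \<Delta> \<turnstile> Bot"
  obtains v where "dom v = UNIV" "\<forall>\<delta>\<in>\<Delta>. {v} \<Turnstile> \<delta>"
proof -
  obtain M where M: "\<Delta> \<subseteq> M" "M \<subseteq> classical" "\<not> M \<turnstile> Bot"
    and "\<forall>\<phi>\<in>classical - M. M \<union> {\<phi>} \<turnstile> Bot"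
    using lindenbaum[OF assms] .
  then have max: "M \<union> {\<phi>} \<turnstile> Bot" if "\<phi> \<in> classical" "\<phi> \<notin> M" for \<phi>
    using that by blast
  have closed: "\<phi> \<in> M" if "M \<turnstile> \<phi>" "\<phi> \<in> classical" for \<phi>
    using cut[OF that(1)] max[OF that(2)] M(3) by blast
  define v where "v p = Some (Var p \<in> M)" for p
  have truth: "{v} \<Turnstile> emb a \<longleftrightarrow> emb a \<in> M" for a
  proof (induction a)
    case (CVar p)
    show ?case by (simp add: v_def)
  next
    case CBot
    show ?case using M(3) by (auto intro: Assm)
  next
    case CTop
    show ?case using closed[of "emb CTop"] by (simp add: TopI del: emb_classical) (metis emb.simps(3) emb_classical)
  next
    case (CNeg a)
    have "Neg a \<in> M" if "emb a \<notin> M"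
      using closed[of "Neg a"] NegI[OF M(2)] max[of "emb a"] that emb_classical[of "CNeg a"] by simp
    moreover have "Neg a \<notin> M" if "emb a \<in> M"
      using NegE[of M a Bot] that M(3) Assm by blast
    ultimately show ?case using CNeg by auto
  next
    case (CAnd a b)
    have "emb (CAnd a b) \<in> M \<longleftrightarrow> emb a \<in> M \<and> emb b \<in> M"
    proof
      assume "emb (CAnd a b) \<in> M"
      then have "M \<turnstile> (emb a \<^bold>\<and> emb b)" by (simp add: Assm)
      then have "M \<turnstile> emb a" "M \<turnstile> emb b" by (rule AndE1, rule AndE2)
      then show "emb a \<in> M \<and> emb b \<in> M" using closed emb_classical by simp
    next
      assume "emb a \<in> M \<and> emb b \<in> M"
      then have "M \<turnstile> emb (CAnd a b)" by (simp add: AndI Assm)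
      then show "emb (CAnd a b) \<in> M" by (rule closed) (rule emb_classical)
    qed
    then show ?case using CAnd by simp
  next
    case (COr a b)
    have "emb (COr a b) \<in> M \<longleftrightarrow> emb a \<in> M \<or> emb b \<in> M"
    proof
      assume "emb (COr a b) \<in> M"
      then have "M \<turnstile> (emb a \<^bold>\<or> emb b)" by (simp add: Assm)
      then have "M \<union> M \<turnstile> Bot" if "emb a \<notin> M" "emb b \<notin> M"
        by (rule OrE[OF M(2)]) (rule max[OF emb_classical], fact)+
      then show "emb a \<in> M \<or> emb b \<in> M" unfolding Un_absorb using M(3) by blast
    next
      assume "emb a \<in> M \<or> emb b \<in> M"
      then have "M \<turnstile> (emb a \<^bold>\<or> emb b)" by (metis OrI1 OrI2 Assm)
      then have "M \<turnstile> emb (COr a b)" by simp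
      then show "emb (COr a b) \<in> M" by (rule closed) (rule emb_classical)
    qed
    then show ?case using COr unfolding emb.simps sat_Or_singleton by blast
  qed
  have "{v} \<Turnstile> \<delta>" if "\<delta> \<in> \<Delta>" for \<delta>
    using that M(1,2) truth unfolding classical_def by blast
  moreover have "dom v = UNIV" by (auto simp: v_def)
  ultimately show ?thesis using that[of v] by simp
qed

lemma classical_completeness:
  assumes "\<Delta> \<subseteq> classical" "\<alpha> \<in> classical"
    and "\<And>v. dom v = UNIV \<Longrightarrow> \<forall>\<delta>\<in>\<Delta>. {v} \<Turnstile> \<delta> \<Longrightarrow> {v} \<Turnstile> \<alpha>"
  shows "\<Delta> \<turnstile> \<alpha>"
proof -
  obtain a where a: "\<alpha> = emb a" using assms(2) by (auto simp: classical_def)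
  have "Neg a \<in> classical" by (metis emb.simps(4) emb_classical)
  with assms(1) have \<Delta>: "\<Delta> \<union> {Neg a} \<subseteq> classical" by simp
  have "\<Delta> \<union> {Neg a} \<turnstile> Bot"
  proof (rule ccontr)
    assume "\<not> \<Delta> \<union> {Neg a} \<turnstile> Bot"
    with \<Delta> obtain v where v: "dom v = UNIV" "\<forall>\<delta>\<in>\<Delta> \<union> {Neg a}. {v} \<Turnstile> \<delta>"
      by (rule classical_model)
    have "{v} \<Turnstile> \<alpha>" by (rule assms(3)[OF v(1)]) (use v(2) in blast)
    moreover have "{v} \<Turnstile> Neg a" using v(2) by blast
    ultimately show False using a by simp
  qed
  then show ?thesis unfolding a by (rule RAA[OF assms(1)])
qed

section \<open>Normal form\<close>

definition basic :: "'p fm list \<Rightarrow> bool" where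
  "basic xs \<longleftrightarrow> xs \<noteq> [] \<and> set xs \<subseteq> classical"

lemma basic_append: "basic xs \<Longrightarrow> basic ys \<Longrightarrow> basic (xs @ ys)"
  by (auto simp: basic_def)

lemma basic_ors_classical: "basic xs \<Longrightarrow> ors xs \<in> classical"
  using ors_classical[of xs] by (simp add: basic_def)

lemma sat_ors_singleton: "{v} \<Turnstile> ors xs \<longleftrightarrow> (\<exists>x\<in>set xs. {v} \<Turnstile> x)"
  by (induction xs) (simp_all add: sat_Or_singleton del: sat.simps(6))

lemma basic_ors_entails:
  assumes "basic xs" "basic ys" "\<Delta> \<subseteq> classical"
    and "\<And>v. \<forall>\<delta>\<in>\<Delta>. {v} \<Turnstile> \<delta> \<Longrightarrow> \<exists>x\<in>set xs. {v} \<Turnstile> x"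
  shows "\<Delta> \<turnstile> ors xs"
proof (rule classical_completeness)
  show "ors xs \<in> classical" using assms(1) by (rule basic_ors_classical)
qed (use assms(3,4) in \<open>simp_all only: sat_ors_singleton\<close>)

text \<open>The conjunction of two basic formulas is basic: \<open>rels xs\<close> and \<open>rels ys\<close> together say that all
  valuations satisfy both \<open>ors xs\<close> and \<open>ors ys\<close>, and that each member of \<open>xs\<close> and of \<open>ys\<close>
  holds somewhere, necessarily at a valuation satisfying the other disjunction.\<close>

definition meet :: "'p fm list \<Rightarrow> 'p fm list \<Rightarrow> 'p fm list" where
  "meet xs ys = map (\<lambda>x. x \<^bold>\<and> ors ys) xs @ map (\<lambda>y. y \<^bold>\<and> ors xs) ys"

lemma basic_meet: "basic xs \<Longrightarrow> basic ys \<Longrightarrow> basic (meet xs ys)"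
  using And_classical basic_ors_classical[of xs] basic_ors_classical[of ys]
  unfolding meet_def by (auto simp: basic_def)

lemma sat_meet_singleton:
  "(\<exists>z\<in>set (meet xs ys). {v} \<Turnstile> z) \<longleftrightarrow> (\<exists>x\<in>set xs. {v} \<Turnstile> x) \<and> (\<exists>y\<in>set ys. {v} \<Turnstile> y)"
  unfolding meet_def set_append set_map bex_Un bex_simps sat.simps(5) sat_ors_singleton by blast

lemma meet_intro:
  assumes xs: "basic xs" and ys: "basic ys" and "\<Gamma> \<turnstile> rels xs" "\<Gamma> \<turnstile> rels ys"
  shows "\<Gamma> \<turnstile> rels (meet xs ys)"
proof (rule rels_intro)
  show "meet xs ys \<noteq> []" "set (meet xs ys) \<subseteq> classical"
    using basic_meet[OF xs ys] by (simp_all add: basic_def)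
  have cl: "ors xs \<in> classical" "ors ys \<in> classical"
    by (rule basic_ors_classical, fact)+
  have o: "\<Gamma> \<turnstile> ors xs" "\<Gamma> \<turnstile> ors ys"
    by (rule cut1[OF _ rels_imp_ors], fact)+
  have "{ors xs, ors ys} \<turnstile> ors (meet xs ys)"
  proof (rule basic_ors_entails[OF basic_meet[OF xs ys] ys])
    show "{ors xs, ors ys} \<subseteq> classical" using cl by simp
    show "\<exists>z\<in>set (meet xs ys). {v} \<Turnstile> z" if "\<forall>\<delta>\<in>{ors xs, ors ys}. {v} \<Turnstile> \<delta>" for v
      using that unfolding sat_meet_singleton by (simp add: sat_ors_singleton)
  qed
  then have "\<Gamma> \<union> {ors xs} \<union> {ors ys} \<turnstile> ors (meet xs ys)" by (rule weaken) simp
  moreover have "\<Gamma> \<union> {ors xs} \<turnstile> ors ys" using o(2) by (rule Weak)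
  ultimately have "\<Gamma> \<union> {ors xs} \<turnstile> ors (meet xs ys)" by (rule cut[rotated])
  with o(1) show "\<Gamma> \<turnstile> ors (meet xs ys)" by (rule cut)
  have x: "\<Gamma> \<turnstile> (x \<or>\<^sub>r Top)" if "x \<in> set xs" for x
    using assms(3) rels_imp_Rel_Top[OF that] by (rule cut1)
  have y: "\<Gamma> \<turnstile> (y \<or>\<^sub>r Top)" if "y \<in> set ys" for y
    using assms(4) rels_imp_Rel_Top[OF that] by (rule cut1)
  have And: "\<Gamma> \<turnstile> ((z \<^bold>\<and> \<beta>) \<or>\<^sub>r Top)" if "\<beta> \<in> classical" "\<Gamma> \<turnstile> \<beta>" "\<Gamma> \<turnstile> (z \<or>\<^sub>r Top)" for z \<beta>
    by (rule RelMon_classical[OF that]) (simp add: AndI Assm)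
  show "\<Gamma> \<turnstile> (z \<or>\<^sub>r Top)" if "z \<in> set (meet xs ys)" for z
  proof -
    from that consider x where "z = x \<^bold>\<and> ors ys" "x \<in> set xs" | y where "z = y \<^bold>\<and> ors xs" "y \<in> set ys"
      unfolding meet_def by auto
    then show ?thesis
    proof cases
      case 1
      then show ?thesis using And[OF cl(2) o(2) x] by simp
    next
      case 2
      then show ?thesis using And[OF cl(1) o(1) y] by simp
    qed
  qed
qed

lemma meet_elim1:
  assumes xs: "basic xs" and ys: "basic ys"
  shows "{rels (meet xs ys)} \<turnstile> rels xs"
proof (rule rels_intro)
  show "xs \<noteq> []" "set xs \<subseteq> classical" using xs by (simp_all add: basic_def)
  have "{ors (meet xs ys)} \<turnstile> ors xs"
  proof (rule basic_ors_entails[OF xs ys])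
    show "{ors (meet xs ys)} \<subseteq> classical"
      using basic_ors_classical[OF basic_meet[OF xs ys]] by simp
    show "\<exists>x\<in>set xs. {v} \<Turnstile> x" if "\<forall>\<delta>\<in>{ors (meet xs ys)}. {v} \<Turnstile> \<delta>" for v
      using that unfolding ball_simps sat_ors_singleton sat_meet_singleton by simp
  qed
  with rels_imp_ors show "{rels (meet xs ys)} \<turnstile> ors xs" by (rule trans1)
  fix x assume "x \<in> set xs"
  then have "{rels (meet xs ys)} \<turnstile> ((x \<^bold>\<and> ors ys) \<or>\<^sub>r Top)"
    by (intro rels_imp_Rel_Top) (simp add: meet_def)
  moreover have "{(x \<^bold>\<and> ors ys) \<or>\<^sub>r Top} \<turnstile> (x \<or>\<^sub>r Top)"
    by (rule Rel_mono1) (rule AndE1[OF refl1])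
  ultimately show "{rels (meet xs ys)} \<turnstile> (x \<or>\<^sub>r Top)" by (rule trans1)
qed

lemma meet_elim2:
  assumes "basic xs" "basic ys"
  shows "{rels (meet xs ys)} \<turnstile> rels ys"
proof -
  have "{rels (meet xs ys)} \<turnstile> rels (meet ys xs)" by (rule rels_set_cong) (auto simp: meet_def)
  also have "{rels (meet ys xs)} \<turnstile> rels ys" using assms by (intro meet_elim1)
  finally show ?thesis .
qed

text \<open>The concatenations of the nonempty sublists of \<open>L\<close>. If a team is divided among several of the
  formulas \<open>rels xs\<close> for \<open>xs\<close> in \<open>L\<close>, then the whole team satisfies \<open>rels\<close> of their
  concatenation.\<close>

primrec joins :: "'a list list \<Rightarrow> 'a list list" where
  "joins [] = []"
| "joins (xs # L) = xs # joins L @ map ((@) xs) (joins L)"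

lemma joins_induct:
  assumes "ys \<in> set (joins L)" "\<And>xs. xs \<in> set L \<Longrightarrow> P xs"
    and "\<And>xs ys. P xs \<Longrightarrow> P ys \<Longrightarrow> P (xs @ ys)"
  shows "P ys"
  using assms(1,2) by (induction L arbitrary: ys) (auto intro: assms(3))

lemma Or_elim:
  assumes "\<Gamma> \<union> {\<phi>} \<turnstile> \<chi>" "\<Gamma> \<union> {\<psi>} \<turnstile> \<chi>" "\<Gamma> \<union> {\<phi> \<or>\<^sub>r \<psi>} \<turnstile> \<chi>"
  shows "\<Gamma> \<union> {\<phi> \<^bold>\<or> \<psi>} \<turnstile> \<chi>"
proof (rule OrERel)
  let ?G = "\<Gamma> \<union> {\<phi> \<^bold>\<or> \<psi>}"
  show "?G \<turnstile> (\<phi> \<^bold>\<or> \<psi>)" by (rule Assm) simp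
  show "?G \<union> {\<phi>} \<turnstile> \<chi>" using assms(1) by (rule weaken) blast
  show "?G \<union> {\<psi>} \<turnstile> \<chi>" using assms(2) by (rule weaken) blast
  show "?G \<union> {\<phi> \<or>\<^sub>r \<psi>} \<turnstile> \<chi>" using assms(3) by (rule weaken) blast
qed

text \<open>Elimination of \<open>ors (map rels L)\<close> produces a case in which one disjunct is joined by
  \<open>\<or>\<^sub>r\<close> to the disjunction of the others. The induction needs that disjunction to be eliminable below
  a relevant disjunction \<open>rels xs\<close>, where the prefix \<open>xs\<close> accumulates the disjuncts already
  chosen.\<close>

lemma Rel_ors_elim:
  assumes "xs \<noteq> []" "[] \<notin> set L" "\<And>ys. ys \<in> set (joins L) \<Longrightarrow> \<Gamma> \<union> {rels (xs @ ys)} \<turnstile> \<chi>"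
  shows "\<Gamma> \<union> {rels xs \<or>\<^sub>r ors (map rels L)} \<turnstile> \<chi>"
  using assms
proof (induction L arbitrary: xs)
  case Nil
  show ?case by (rule RelBotE[of _ "rels xs"]) (simp add: Assm)
next
  case (Cons zs L)
  let ?O = "ors (map rels L)"
  have zs: "zs \<noteq> []" "[] \<notin> set L" using Cons.prems(2) by auto
  have 1: "\<Gamma> \<union> {rels xs \<or>\<^sub>r rels zs} \<turnstile> \<chi>"
  proof (rule replace)
    show "\<Gamma> \<union> {rels (xs @ zs)} \<turnstile> \<chi>" by (rule Cons.prems(3)) simp
    show "{rels xs \<or>\<^sub>r rels zs} \<turnstile> rels (xs @ zs)" using Cons.prems(1) zs(1) by (rule rels_append(2))
  qed
  have 2: "\<Gamma> \<union> {rels xs \<or>\<^sub>r ?O} \<turnstile> \<chi>"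
    by (rule Cons.IH[OF Cons.prems(1) zs(2)]) (rule Cons.prems(3), simp)
  have 3: "\<Gamma> \<union> {(rels xs \<or>\<^sub>r rels zs) \<or>\<^sub>r (rels xs \<or>\<^sub>r ?O)} \<turnstile> \<chi>"
  proof (rule replace)
    show "\<Gamma> \<union> {rels (xs @ zs) \<or>\<^sub>r ?O} \<turnstile> \<chi>"
    proof (rule Cons.IH)
      show "xs @ zs \<noteq> []" using zs(1) by simp
      show "\<Gamma> \<union> {rels ((xs @ zs) @ ys)} \<turnstile> \<chi>" if "ys \<in> set (joins L)" for ys
        unfolding append_assoc by (rule Cons.prems(3)) (simp add: that)
    qed (rule zs(2))
    let ?X = "rels xs" and ?Z = "rels zs"
    \<comment> \<open>Viewed as lists of formulas, both sides differ only in the repetition of \<open>?X\<close>.\<close>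
    have "{(?X \<or>\<^sub>r ?Z) \<or>\<^sub>r (?X \<or>\<^sub>r ?O)} \<turnstile> rels ([?X, ?Z] @ [?X, ?O])"
      using rels_append(2)[of "[?X, ?Z]" "[?X, ?O]"] by simp
    also have "{rels ([?X, ?Z] @ [?X, ?O])} \<turnstile> rels [?X, ?Z, ?O]"
      by (rule rels_set_cong) auto
    also have "{rels [?X, ?Z, ?O]} \<turnstile> ((?X \<or>\<^sub>r ?Z) \<or>\<^sub>r ?O)"
      using Rel_assoc by simp
    also have "{(?X \<or>\<^sub>r ?Z) \<or>\<^sub>r ?O} \<turnstile> (rels (xs @ zs) \<or>\<^sub>r ?O)"
      using Cons.prems(1) zs(1) by (intro Rel_mono1 rels_append(2))
    finally show "{(?X \<or>\<^sub>r ?Z) \<or>\<^sub>r (?X \<or>\<^sub>r ?O)} \<turnstile> (rels (xs @ zs) \<or>\<^sub>r ?O)" .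
  qed
  have "\<Gamma> \<union> {(rels xs \<or>\<^sub>r rels zs) \<^bold>\<or> (rels xs \<or>\<^sub>r ?O)} \<turnstile> \<chi>"
    using 1 2 3 by (rule Or_elim)
  then have "\<Gamma> \<union> {rels xs \<or>\<^sub>r (rels zs \<^bold>\<or> ?O)} \<turnstile> \<chi>"
    by (rule replace) (rule DstrRelOr, rule refl1)
  then show ?case by simp
qed

lemma ors_rels_elim:
  assumes "[] \<notin> set L" "\<And>ys. ys \<in> set (joins L) \<Longrightarrow> \<Gamma> \<union> {rels ys} \<turnstile> \<chi>"
  shows "\<Gamma> \<union> {ors (map rels L)} \<turnstile> \<chi>"
  using assms
proof (induction L)
  case Nil
  show ?case by (rule ex_falso) (simp add: Assm)
next
  case (Cons zs L)
  let ?O = "ors (map rels L)"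
  have zs: "zs \<noteq> []" "[] \<notin> set L" using Cons.prems(1) by auto
  have 1: "\<Gamma> \<union> {rels zs} \<turnstile> \<chi>" by (rule Cons.prems(2)) simp
  have 2: "\<Gamma> \<union> {?O} \<turnstile> \<chi>" by (rule Cons.IH[OF zs(2)]) (rule Cons.prems(2), simp)
  have 3: "\<Gamma> \<union> {rels zs \<or>\<^sub>r ?O} \<turnstile> \<chi>"
    by (rule Rel_ors_elim[OF zs]) (rule Cons.prems(2), simp)
  have "\<Gamma> \<union> {rels zs \<^bold>\<or> ?O} \<turnstile> \<chi>" using 1 2 3 by (rule Or_elim)
  then show ?case by simp
qed

text \<open>The second conjunct asks only for the disjunction to follow from \<open>\<phi>\<close>; the converse is contained in
  the first one, disjunct by disjunct, which is the form that survives the passage from \<open>L\<close> to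
  \<open>joins L\<close>.\<close>

definition normal_form :: "'p fm \<Rightarrow> 'p fm list list \<Rightarrow> bool" where
  "normal_form \<phi> L \<longleftrightarrow>
     (\<forall>xs\<in>set L. basic xs \<and> {rels xs} \<turnstile> \<phi>) \<and> {\<phi>} \<turnstile> ors (map rels L)"

lemma normal_form_joins:
  assumes "normal_form \<phi> L" "xs \<in> set (joins L)"
  shows "basic xs \<and> {rels xs} \<turnstile> \<phi>"
proof (rule joins_induct[OF assms(2)])
  show "basic zs \<and> {rels zs} \<turnstile> \<phi>" if "zs \<in> set L" for zs
    using assms(1) that by (simp add: normal_form_def)
next
  fix ys zs assume yz: "basic ys \<and> {rels ys} \<turnstile> \<phi>" "basic zs \<and> {rels zs} \<turnstile> \<phi>"
  then have "ys \<noteq> []" "zs \<noteq> []" by (simp_all add: basic_def)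
  then have "{rels (ys @ zs)} \<turnstile> (rels ys \<or>\<^sub>r rels zs)" by (rule rels_append(1))
  also have "{rels ys \<or>\<^sub>r rels zs} \<turnstile> (\<phi> \<or>\<^sub>r \<phi>)" using yz by (intro Rel_mono) simp_all
  also have "{\<phi> \<or>\<^sub>r \<phi>} \<turnstile> \<phi>" by (rule Rel_idem)
  finally show "basic (ys @ zs) \<and> {rels (ys @ zs)} \<turnstile> \<phi>" using yz basic_append by blast
qed

text \<open>Case distinction on the basic formulas that make up \<open>\<phi>\<close>. The side assumptions \<open>\<Gamma>\<close> need not
  be classical, so it applies to maximal sets.\<close>

lemma normal_form_elim:
  assumes "normal_form \<phi> L" "\<Gamma> \<turnstile> \<phi>" "\<And>xs. xs \<in> set (joins L) \<Longrightarrow> \<Gamma> \<union> {rels xs} \<turnstile> \<chi>"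
  shows "\<Gamma> \<turnstile> \<chi>"
proof (rule cut)
  show "\<Gamma> \<turnstile> ors (map rels L)" using assms(1,2) by (auto simp: normal_form_def intro: cut1)
  have "[] \<notin> set L" using assms(1) by (auto simp: normal_form_def basic_def)
  then show "\<Gamma> \<union> {ors (map rels L)} \<turnstile> \<chi>" using assms(3) by (rule ors_rels_elim)
qed

lemma normal_form_classical: "\<alpha> \<in> classical \<Longrightarrow> normal_form \<alpha> [[\<alpha>]]"
  by (simp add: normal_form_def basic_def refl1 OrI1)

text \<open>Conjunction does not distribute over the tensor disjunction itself, but it does over the case
  distinctions of \<open>normal_form_elim\<close>; hence the disjuncts come from \<open>joins L\<close> and
  \<open>joins M\<close>.\<close>

lemma normal_form_And:
  assumes "normal_form \<phi> L" "normal_form \<psi> M"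
  shows "normal_form (\<phi> \<^bold>\<and> \<psi>) [meet xs ys. xs \<leftarrow> joins L, ys \<leftarrow> joins M]"
    (is "normal_form _ ?N")
  unfolding normal_form_def
proof (intro conjI ballI)
  fix zs assume "zs \<in> set ?N"
  then obtain xs ys where zs: "zs = meet xs ys" "xs \<in> set (joins L)" "ys \<in> set (joins M)" by auto
  note x = normal_form_joins[OF assms(1) zs(2)] and y = normal_form_joins[OF assms(2) zs(3)]
  show "basic zs" using zs(1) x y basic_meet by blast
  show "{rels zs} \<turnstile> (\<phi> \<^bold>\<and> \<psi>)"
    unfolding zs(1) using x y by (intro AndI) (blast intro: trans1 meet_elim1 meet_elim2)+
next
  let ?G = "{\<phi> \<^bold>\<and> \<psi>}"
  show "?G \<turnstile> ors (map rels ?N)"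
  proof (rule normal_form_elim[OF assms(1) AndE1[OF refl1]])
    fix xs assume xs: "xs \<in> set (joins L)"
    have "?G \<union> {rels xs} \<turnstile> \<psi>" by (rule AndE2[of _ \<phi>]) (simp add: Assm)
    with assms(2) show "?G \<union> {rels xs} \<turnstile> ors (map rels ?N)"
    proof (rule normal_form_elim)
      fix ys assume ys: "ys \<in> set (joins M)"
      have "?G \<union> {rels xs} \<union> {rels ys} \<turnstile> rels (meet xs ys)"
        using normal_form_joins[OF assms(1) xs] normal_form_joins[OF assms(2) ys]
        by (intro meet_intro Assm) simp_all
      then show "?G \<union> {rels xs} \<union> {rels ys} \<turnstile> ors (map rels ?N)"
        by (rule cut1) (rule ors_upper, use xs ys in auto)
    qed
  qed
qed

lemma normal_form_Or:
  assumes "normal_form \<phi> L" "normal_form \<psi> M"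
  shows "normal_form (\<phi> \<^bold>\<or> \<psi>) (L @ M)"
  unfolding normal_form_def
proof (intro conjI ballI)
  fix zs assume "zs \<in> set (L @ M)"
  then show "basic zs" "{rels zs} \<turnstile> (\<phi> \<^bold>\<or> \<psi>)"
    using assms by (auto simp: normal_form_def intro: OrI1 OrI2)
next
  let ?O = "ors (map rels (L @ M))"
  have "{ors (map rels L)} \<turnstile> ?O" "{ors (map rels M)} \<turnstile> ?O"
    by (rule ors_least, rule ors_upper, force)+
  then show "{\<phi> \<^bold>\<or> \<psi>} \<turnstile> ?O"
    using assms unfolding normal_form_def by (metis Or_least cut1)
qed

text \<open>Relevant disjunction distributes over the tensor disjunction in both arguments by \<open>DstrRelOr\<close>.\<close>

lemma normal_form_Rel:
  assumes "normal_form \<phi> L" "normal_form \<psi> M"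
  shows "normal_form (\<phi> \<or>\<^sub>r \<psi>) [xs @ ys. xs \<leftarrow> L, ys \<leftarrow> M]" (is "normal_form _ ?N")
  unfolding normal_form_def
proof (intro conjI ballI)
  fix zs assume "zs \<in> set ?N"
  then obtain xs ys where zs: "zs = xs @ ys" "xs \<in> set L" "ys \<in> set M" by auto
  then have x: "basic xs" "{rels xs} \<turnstile> \<phi>" and y: "basic ys" "{rels ys} \<turnstile> \<psi>"
    using assms by (simp_all add: normal_form_def)
  show "basic zs" using zs(1) x y basic_append by blast
  show "{rels zs} \<turnstile> (\<phi> \<or>\<^sub>r \<psi>)"
    unfolding zs(1) using rels_append(1) Rel_mono[OF x(2) y(2)]
    by (rule trans1) (use x y in \<open>simp_all add: basic_def\<close>)
next
  let ?O = "ors (map rels ?N)" and ?L = "ors (map rels L)" and ?M = "ors (map rels M)"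
  have "{rels xs \<or>\<^sub>r rels ys} \<turnstile> ?O" if "xs \<in> set L" "ys \<in> set M" for xs ys
  proof (rule trans1)
    show "{rels xs \<or>\<^sub>r rels ys} \<turnstile> rels (xs @ ys)"
      using that assms by (intro rels_append(2)) (auto simp: normal_form_def basic_def)
    show "{rels (xs @ ys)} \<turnstile> ?O" by (rule ors_upper) (use that in auto)
  qed
  then have "{rels xs \<or>\<^sub>r ?M} \<turnstile> ?O" if "xs \<in> set L" for xs
    using that by (intro Rel_ors_least) auto
  then have "{?M \<or>\<^sub>r rels xs} \<turnstile> ?O" if "xs \<in> set L" for xs
    using that Rel_comm by (blast intro: trans1)
  then have "{?M \<or>\<^sub>r ?L} \<turnstile> ?O" by (intro Rel_ors_least) auto
  then have "{?L \<or>\<^sub>r ?M} \<turnstile> ?O" by (rule trans1[OF Rel_comm])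
  moreover have "{\<phi> \<or>\<^sub>r \<psi>} \<turnstile> (?L \<or>\<^sub>r ?M)"
    using assms by (intro Rel_mono) (simp_all add: normal_form_def)
  ultimately show "{\<phi> \<or>\<^sub>r \<psi>} \<turnstile> ?O" by (rule trans1[rotated])
qed

lemma normal_form_exists: "\<exists>L. normal_form \<phi> L"
proof (induction \<phi>)
  case (Var p)
  show ?case using normal_form_classical[OF emb_classical, of "CVar p"] by auto
next
  case Bot
  show ?case using normal_form_classical[OF emb_classical, of CBot] by auto
next
  case Top
  show ?case using normal_form_classical[OF emb_classical, of CTop] by auto
next
  case (Neg a)
  show ?case using normal_form_classical[OF emb_classical, of "CNeg a"] by auto
next
  case (And \<phi> \<psi>)
  then show ?case by (meson normal_form_And)
next
  case (Or \<phi> \<psi>)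
  then show ?case by (meson normal_form_Or)
next
  case (Rel \<phi> \<psi>)
  then show ?case by (meson normal_form_Rel)
qed

section \<open>The canonical team\<close>

lemma sat_rels:
  assumes "basic xs" "X \<noteq> {}"
  shows "X \<Turnstile> rels xs \<longleftrightarrow>
    (\<forall>v\<in>X. \<exists>x\<in>set xs. {v} \<Turnstile> x) \<and> (\<forall>x\<in>set xs. \<exists>v\<in>X. {v} \<Turnstile> x)"
  using assms
proof (induction xs arbitrary: X rule: rels.induct)
  case 1
  then show ?case by (simp add: basic_def)
next
  case (2 x)
  then have "X \<Turnstile> x \<longleftrightarrow> (\<forall>v\<in>X. {v} \<Turnstile> x)" by (intro classical_flat) (simp add: basic_def)
  then show ?case using 2(2) by (auto simp del: sat.simps)
next
  case (3 x y ys)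
  let ?r = "y # ys"
  have x: "x \<in> classical" and r: "basic ?r" using 3(2) by (simp_all add: basic_def)
  show ?case (is "_ \<longleftrightarrow> ?R")
  proof
    assume "X \<Turnstile> rels (x # ?r)"
    then obtain Y Z where YZ: "X = Y \<union> Z" "Y \<Turnstile> x" "Z \<Turnstile> rels ?r" "Y \<noteq> {}" "Z \<noteq> {}"
      unfolding rels.simps using 3(3) by (rule sat_RelE)
    have "\<forall>v\<in>Y. {v} \<Turnstile> x" using YZ(2) classical_flat[OF x] by blast
    moreover have "(\<forall>v\<in>Z. \<exists>x\<in>set ?r. {v} \<Turnstile> x) \<and> (\<forall>x\<in>set ?r. \<exists>v\<in>Z. {v} \<Turnstile> x)"
      using YZ(3) 3(1)[OF r YZ(5)] by blast
    moreover have "\<exists>v. v \<in> Y" using YZ(4) by blast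
    ultimately show ?R unfolding list.set(2)[of x] YZ(1) by blast
  next
    assume R: ?R
    define Y where "Y = {v\<in>X. {v} \<Turnstile> x}"
    define Z where "Z = {v\<in>X. \<exists>z\<in>set ?r. {v} \<Turnstile> z}"
    have "Y \<noteq> {}" using R by (auto simp: Y_def simp del: sat.simps)
    have "Z \<noteq> {}" using R by (auto simp: Z_def simp del: sat.simps)
    have "\<forall>v\<in>Z. \<exists>z\<in>set ?r. {v} \<Turnstile> z" unfolding Z_def by blast
    moreover have "\<forall>z\<in>set ?r. \<exists>v\<in>Z. {v} \<Turnstile> z"
      using R unfolding Z_def list.set(2)[of x] by blast
    ultimately have "Z \<Turnstile> rels ?r" using 3(1)[OF r \<open>Z \<noteq> {}\<close>] by blast
    moreover have "Y \<Turnstile> x" using classical_flat[OF x, of Y] unfolding Y_def by blast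
    moreover have "X = Y \<union> Z" using R unfolding Y_def Z_def list.set(2)[of x] by blast
    ultimately show "X \<Turnstile> rels (x # ?r)"
      unfolding rels.simps using \<open>Y \<noteq> {}\<close> \<open>Z \<noteq> {}\<close> by (intro sat_RelI[of Y _ Z])
  qed
qed

lemma sat_derives1: "{\<phi>} \<turnstile> \<psi> \<Longrightarrow> X \<Turnstile> \<phi> \<Longrightarrow> X \<Turnstile> \<psi>"
  by (erule soundness) simp

lemma joins_Nil: "[] \<notin> set L \<Longrightarrow> [] \<notin> set (joins L)"
  using joins_induct[of "[]" L "\<lambda>xs. xs \<noteq> []"] by auto

text \<open>The semantic counterpart of \<open>ors_rels_elim\<close>: the disjuncts that receive a nonempty part of
  \<open>X\<close> are concatenated.\<close>

lemma sat_ors_joins: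
  assumes "[] \<notin> set L" "X \<Turnstile> ors (map rels L)" "X \<noteq> {}"
  shows "\<exists>xs\<in>set (joins L). X \<Turnstile> rels xs"
  using assms
proof (induction L arbitrary: X)
  case Nil
  then show ?case by simp
next
  case (Cons xs L)
  have L: "xs \<noteq> []" "[] \<notin> set L" using Cons.prems(1) by auto
  obtain Y Z where YZ: "X = Y \<union> Z" "Y \<Turnstile> rels xs" "Z \<Turnstile> ors (map rels L)"
    using Cons.prems(2) unfolding ors.simps list.map by (rule sat_OrE)
  show ?case
  proof (cases "Z = {}")
    case True
    then show ?thesis using YZ by simp
  next
    case False
    then obtain ys where ys: "ys \<in> set (joins L)" "Z \<Turnstile> rels ys"
      using Cons.IH[OF L(2) YZ(3)] by blast
    show ?thesis
    proof (cases "Y = {}")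
      case True
      then show ?thesis using YZ ys by auto
    next
      case Y: False
      have "ys \<noteq> []" using joins_Nil[OF L(2)] ys(1) by metis
      have "X \<Turnstile> (rels xs \<or>\<^sub>r rels ys)"
        using YZ(2) ys(2) YZ(1) Y False by (rule sat_RelI)
      with rels_append(2)[OF L(1) \<open>ys \<noteq> []\<close>] have "X \<Turnstile> rels (xs @ ys)" by (rule sat_derives1)
      then show ?thesis using ys(1) by auto
    qed
  qed
qed

lemma countermodel:
  assumes "\<not> \<Gamma> \<turnstile> \<chi>"
  obtains X where "is_team UNIV X" "\<forall>\<gamma>\<in>\<Gamma>. X \<Turnstile> \<gamma>" "\<not> X \<Turnstile> \<chi>"
proof -
  obtain T where T: "\<Gamma> \<subseteq> T" "T \<subseteq> UNIV" "\<not> T \<turnstile> \<chi>" and T4: "\<forall>\<phi>\<in>UNIV - T. T \<union> {\<phi>} \<turnstile> \<chi>"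
    by (rule lindenbaum[OF subset_UNIV assms])
  have max: "T \<union> {\<phi>} \<turnstile> \<chi>" if "\<phi> \<notin> T" for \<phi>
    using T4 that by simp
  have closed: "\<phi> \<in> T" if "T \<turnstile> \<phi>" for \<phi>
    using cut[OF that] max T(3) by blast
  define X where "X = {v. dom v = UNIV \<and> (\<forall>\<alpha>\<in>T \<inter> classical. {v} \<Turnstile> \<alpha>)}"
  have classical_T: "\<alpha> \<in> T \<longleftrightarrow> (\<forall>v\<in>X. {v} \<Turnstile> \<alpha>)" if \<alpha>: "\<alpha> \<in> classical" for \<alpha>
  proof
    assume "\<alpha> \<in> T"
    then show "\<forall>v\<in>X. {v} \<Turnstile> \<alpha>" using \<alpha> unfolding X_def by blast
  next
    assume a: "\<forall>v\<in>X. {v} \<Turnstile> \<alpha>"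
    have "T \<inter> classical \<turnstile> \<alpha>"
      by (rule classical_completeness[OF Int_lower2 \<alpha>]) (use a X_def in blast)
    then show "\<alpha> \<in> T" by (intro closed) (erule weaken, rule Int_lower1)
  qed
  have "X \<noteq> {}"
  proof
    assume "X = {}"
    then have "emb CBot \<in> T" using classical_T[OF emb_classical, of CBot] by simp
    then have "T \<turnstile> Bot" by (simp add: Assm)
    then show False using T(3) ex_falso by blast
  qed
  \<comment> \<open>Left to right: were \<open>\<alpha>\<close> true nowhere in \<open>X\<close>, the classical part of \<open>T\<close> would refute it, and
    \<open>\<alpha> \<or>\<^sub>r Top\<close> would turn into \<open>Bot \<or>\<^sub>r Top\<close>. Right to left: of the three cases of
    excluded middle for \<open>\<alpha>\<close>, the two besides \<open>\<not> \<alpha>\<close> imply \<open>\<alpha> \<or>\<^sub>r Top\<close>.\<close>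
  have Rel_Top_T: "(\<alpha> \<or>\<^sub>r Top) \<in> T \<longleftrightarrow> (\<exists>v\<in>X. {v} \<Turnstile> \<alpha>)" if \<alpha>: "\<alpha> \<in> classical" for \<alpha>
  proof
    assume in_T: "(\<alpha> \<or>\<^sub>r Top) \<in> T"
    show "\<exists>v\<in>X. {v} \<Turnstile> \<alpha>"
    proof (rule ccontr)
      assume none: "\<not> (\<exists>v\<in>X. {v} \<Turnstile> \<alpha>)"
      have "T \<inter> classical \<union> {\<alpha>} \<turnstile> emb CBot"
      proof (rule classical_completeness)
        show "T \<inter> classical \<union> {\<alpha>} \<subseteq> classical" using \<alpha> by simp
        show "{v} \<Turnstile> emb CBot" if "dom v = UNIV" "\<forall>\<delta>\<in>T \<inter> classical \<union> {\<alpha>}. {v} \<Turnstile> \<delta>" for v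
          using none that unfolding X_def by blast
      qed (rule emb_classical)
      then have "T \<union> T \<inter> classical \<turnstile> (Bot \<or>\<^sub>r Top)"
        by (intro RelMon[OF Int_lower2 Assm[OF in_T]]) simp
      then have "T \<turnstile> (Top \<or>\<^sub>r Bot)" by (simp add: Un_absorb2 RelCom)
      then have "T \<turnstile> \<chi>" by (rule RelBotE)
      then show False using T(3) by contradiction
    qed
  next
    assume "\<exists>v\<in>X. {v} \<Turnstile> \<alpha>"
    then obtain v where v: "v \<in> X" "{v} \<Turnstile> \<alpha>" by (rule bexE)
    obtain a where a: "\<alpha> = emb a" using \<alpha> unfolding classical_def by (rule rangeE)
    show "(\<alpha> \<or>\<^sub>r Top) \<in> T"
    proof (rule ccontr)
      assume "(\<alpha> \<or>\<^sub>r Top) \<notin> T"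
      then have D: "T \<union> {\<alpha> \<or>\<^sub>r Top} \<turnstile> \<chi>" by (rule max)
      have "{} \<turnstile> emb (COr (CNeg a) a)"
        by (rule classical_completeness[OF empty_subsetI emb_classical])
          (simp add: sat_Or_singleton del: sat.simps(6))
      then have "T \<turnstile> (Neg a \<^bold>\<or> \<alpha>)" using weaken[of "{}" _ T] by (simp add: a)
      moreover have "T \<union> {Neg a} \<turnstile> \<chi>"
      proof (rule max)
        have "\<not> {v} \<Turnstile> emb (CNeg a)" using v(2) by (simp add: a)
        then have "emb (CNeg a) \<notin> T" using classical_T[OF emb_classical] v(1) by blast
        then show "Neg a \<notin> T" by simp
      qed
      moreover have "T \<union> {\<alpha>} \<turnstile> \<chi>" by (rule replace[OF D]) (rule RelI[OF refl1 TopI])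
      moreover have "T \<union> {Neg a \<or>\<^sub>r \<alpha>} \<turnstile> \<chi>"
        by (rule replace[OF D]) (rule RelCom, rule Rel_mono1, rule TopI)
      ultimately have "T \<turnstile> \<chi>" by (rule OrERel)
      then show False using T(3) by contradiction
    qed
  qed
  have rels_T: "rels xs \<in> T \<longleftrightarrow> X \<Turnstile> rels xs" if xs: "basic xs" for xs
  proof -
    have ne: "xs \<noteq> []" and cl: "set xs \<subseteq> classical" using xs by (simp_all add: basic_def)
    have "rels xs \<in> T \<longleftrightarrow> ors xs \<in> T \<and> (\<forall>x\<in>set xs. (x \<or>\<^sub>r Top) \<in> T)"
    proof
      assume "rels xs \<in> T"
      then have "T \<turnstile> rels xs" by (rule Assm)
      then show "ors xs \<in> T \<and> (\<forall>x\<in>set xs. (x \<or>\<^sub>r Top) \<in> T)"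
        using closed cut1 rels_imp_ors rels_imp_Rel_Top by meson
    next
      assume "ors xs \<in> T \<and> (\<forall>x\<in>set xs. (x \<or>\<^sub>r Top) \<in> T)"
      then have "T \<turnstile> rels xs" by (intro rels_intro[OF ne cl] Assm) simp_all
      then show "rels xs \<in> T" by (rule closed)
    qed
    also have "ors xs \<in> T \<longleftrightarrow> (\<forall>v\<in>X. \<exists>x\<in>set xs. {v} \<Turnstile> x)"
      unfolding classical_T[OF basic_ors_classical[OF xs]] sat_ors_singleton ..
    also have "(\<forall>x\<in>set xs. (x \<or>\<^sub>r Top) \<in> T) \<longleftrightarrow> (\<forall>x\<in>set xs. \<exists>v\<in>X. {v} \<Turnstile> x)"
      by (rule ball_cong[OF refl], rule Rel_Top_T) (rule subsetD[OF cl])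
    finally show ?thesis unfolding sat_rels[OF xs \<open>X \<noteq> {}\<close>] .
  qed
  have "X \<Turnstile> \<gamma>" if \<gamma>: "\<gamma> \<in> \<Gamma>" for \<gamma>
  proof -
    obtain L where L: "normal_form \<gamma> L" using normal_form_exists ..
    have "T \<turnstile> \<gamma>" using \<gamma> T(1) by (intro Assm) blast
    then obtain xs where xs: "xs \<in> set (joins L)" "\<not> T \<union> {rels xs} \<turnstile> \<chi>"
      using normal_form_elim[OF L] T(3) by metis
    have nf: "basic xs" "{rels xs} \<turnstile> \<gamma>" using normal_form_joins[OF L xs(1)] by simp_all
    have "rels xs \<in> T" using max xs(2) by metis
    with nf(1) have "X \<Turnstile> rels xs" using rels_T by simp
    with nf(2) show ?thesis by (rule sat_derives1)
  qed
  moreover have "\<not> X \<Turnstile> \<chi>"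
  proof
    assume "X \<Turnstile> \<chi>"
    obtain L where L: "normal_form \<chi> L" using normal_form_exists ..
    have "X \<Turnstile> ors (map rels L)"
      using L \<open>X \<Turnstile> \<chi>\<close> unfolding normal_form_def by (metis sat_derives1)
    moreover have "[] \<notin> set L" using L by (auto simp: normal_form_def basic_def)
    ultimately obtain xs where xs: "xs \<in> set (joins L)" "X \<Turnstile> rels xs"
      using sat_ors_joins[OF _ _ \<open>X \<noteq> {}\<close>] by metis
    have nf: "basic xs" "{rels xs} \<turnstile> \<chi>" using normal_form_joins[OF L xs(1)] by simp_all
    have "T \<turnstile> rels xs" using rels_T[OF nf(1)] xs(2) by (intro Assm) simp
    then have "T \<turnstile> \<chi>" using nf(2) by (rule cut1)
    then show False using T(3) by contradiction
  qed
  moreover have "is_team UNIV X" by (simp add: is_team_def X_def)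
  ultimately show ?thesis using that[of X] by metis
qed

theorem theorem4p7:
  fixes \<Gamma> :: "'p fm set" and \<phi> :: "'p fm"
  shows "\<Gamma> \<TTurnstile> \<phi> \<longleftrightarrow> \<Gamma> \<turnstile> \<phi>"
proof
  assume entails: "\<Gamma> \<TTurnstile> \<phi>"
  show "\<Gamma> \<turnstile> \<phi>"
  proof (rule ccontr)
    assume "\<not> \<Gamma> \<turnstile> \<phi>"
    then obtain X where "is_team UNIV X" "\<forall>\<gamma>\<in>\<Gamma>. X \<Turnstile> \<gamma>" "\<not> X \<Turnstile> \<phi>"
      by (rule countermodel)
    then show False using entails unfolding entails_def by blast
  qed
next
  assume "\<Gamma> \<turnstile> \<phi>"
  then show "\<Gamma> \<TTurnstile> \<phi>" unfolding entails_def by (auto elim: soundness)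
qed

end
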